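(* Suppose that $\lambda_1\ge\dots\ge\lambda_{\tilde d}$, $\lambda_d>0$ and $\lambda_d>\lambda_{d+1}$. Let $n\in\{1,\dots,\ell\}$ and let $\sigma\in\mathbb{R}^{\tilde d-d}$ be the vector defined in the context (for this $n$). Suppose that $\|\sigma\|_1<1$ (so that the $n$th iteration of CG on $(\tilde A,\tilde b)$ is well defined). Let $v\in\mathbb{R}^d$ and $\tilde v\in\mathbb{R}^{\tilde d}$ denote the $n$th iterates of CG on $(A,b)$ and $(\tilde A,\tilde b)$ respectively. Then $$\|\tilde v_{1:d}-v\|\le\frac{\|\sigma\|_1}{1-\|\sigma\|_1}\|v\|\qquad\text{and}\qquad|\tilde v_i|\le\frac{|b_i|}{1-\|\sigma\|_1}\bigg|\frac{(1-\lambda_i/\lambda_d)^n-1}{\lambda_i}\bigg|$$ for all $i\in\{d+1,\dots,\tilde d\}$, where $\tilde v_{1:d}$ is the vector of the first $d$ entries of $\tilde v$, and where the last absolute value is understood as $n/\lambda_d$ when $\lambda_i=0$.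
   Context: Let $\tilde d\ge d$ be positive integers, $\lambda_1,\dots,\lambda_{\tilde d}\in\mathbb{R}$ and $b_1,\dots,b_{\tilde d}\in\mathbb{R}$. Let $A=\mathrm{diag}(\lambda_1,\dots,\lambda_d)$, $b=(b_1,\dots,b_d)^\top$, $\tilde A=\mathrm{diag}(\lambda_1,\dots,\lambda_{\tilde d})$, $\tilde b=(b_1,\dots,b_{\tilde d})^\top$. For a symmetric matrix $M$ and vector $c$, the $n$th Krylov space is $\mathcal{K}_n(M,c)=\mathrm{span}\{c,Mc,\dots,M^{n-1}c\}$ and the grade is the largest $n$ with $\dim\mathcal{K}_n(M,c)=n$. Let $\ell$ be the grade of $(A,b)$. The $n$th iteration of CG (conjugate gradients started at zero) on $(M,c)$ is well defined if $n$ is at most the grade of $(M,c)$ and $v^\top Mv>0$ for all nonzero $v\in\mathcal{K}_n(M,c)$; in that case the $n$th iterate is the unique minimizer of $\frac12v^\top Mv-c^\top v$ over $v\in\mathcal{K}_n(M,c)$. $\mathcal{P}_{\le n}$ is the space of real univariate polynomials of degree at most $n$. On polynomials define $\langle p,q\rangle=\sum_{i=1}^d b_i^2p(\lambda_i)q(\lambda_i)$, with induced semi-norm $\|\cdot\|$ (for vectors, $\|\cdot\|$ is the Euclidean norm). For $n\le\ell$, $\pi_n$ is the unique minimizer of $\|\pi\|^2$ over $\pi\in\mathcal{P}_{\le n}$ whose coefficient of degree $n$ equals $1$. For $d<j\le\tilde d$ and $0\le n<\ell$, $\zeta_n^j$ is the unique minimizer of $\|\zeta\|^2$ over $\zeta\in\mathcal{P}_{\le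 n}$ subject to $\zeta(\lambda_j)=1$. Under the stated assumptions on the $\lambda_i$, all roots of $\pi_n$ and $\zeta_n^j$ are real and positive; define $\varsigma_n=\pi_n/\pi_n(0)$ and $\xi_n^j=\zeta_n^j/\zeta_n^j(0)$. Definition of $\sigma$ (for a given $n\in\{1,\dots,\ell\}$; indices $i,j$ run over $\{d+1,\dots,\tilde d\}$): $B=\mathrm{diag}(b_{d+1},\dots,b_{\tilde d})$, $C_{ij}=\xi_{n-1}^j(\lambda_i)$, $D$ diagonal with $D_{jj}=\|\xi_{n-1}^j\|^2/\xi_{n-1}^j(\lambda_j)$, $w_i=\varsigma_n(\lambda_i)$, and $\sigma=(D+B^2C)^{-1}B^2w$ (the inverse exists). $\|\sigma\|_1=\sum_j|\sigma_j|$. *)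

theory Defs
  imports
    Jordan_Normal_Form.VS_Connect
    Jordan_Normal_Form.Gauss_Jordan_Elimination
begin

text \<open>
  Indices start at 0 throughout: \<open>lam i\<close> and \<open>b i\<close> stand for \<open>\<lambda>\<^sub>i\<^sub>+\<^sub>1\<close> and \<open>b\<^sub>i\<^sub>+\<^sub>1\<close>.
  Indices below \<open>d\<close> belong to the original problem, and those from \<open>d\<close> up to (excluding) \<open>dt\<close>
  to the extension, where \<open>dt\<close> is the extended dimension.
\<close>

definition euclid_norm :: "real vec \<Rightarrow> real" where
  "euclid_norm v = sqrt (v \<bullet> v)"

definition l1_norm :: "real vec \<Rightarrow> real" where
  "l1_norm v = (\<Sum>i<dim_vec v. \<bar>v $ i\<bar>)"

definition the_minimizer :: "('a \<Rightarrow> real) \<Rightarrow> ('a \<Rightarrow> bool) \<Rightarrow> 'a" where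
  "the_minimizer f P = (THE x. is_arg_min f P x)"


subsection \<open>Krylov spaces and conjugate gradients\<close>

definition krylov :: "real mat \<Rightarrow> real vec \<Rightarrow> nat \<Rightarrow> real vec set" where
  "krylov M c n =
     LinearCombinations.module.span class_ring (module_vec TYPE(real) (dim_vec c))
       ((\<lambda>k. (M ^\<^sub>m k) *\<^sub>v c) ` {..<n})"

definition krylov_dim :: "real mat \<Rightarrow> real vec \<Rightarrow> nat \<Rightarrow> nat" where
  "krylov_dim M c n =
     vectorspace.dim class_ring
       (module_vec TYPE(real) (dim_vec c)\<lparr>carrier := krylov M c n\<rparr>)"

definition krylov_grade :: "real mat \<Rightarrow> real vec \<Rightarrow> nat" where
  "krylov_grade M c = (GREATEST n. krylov_dim M c n = n)"

definition cg_well_defined :: "real mat \<Rightarrow> real vec \<Rightarrow> nat \<Rightarrow> bool" where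
  "cg_well_defined M c n \<longleftrightarrow>
     n \<le> krylov_grade M c \<and>
     (\<forall>v \<in> krylov M c n. v \<noteq> 0\<^sub>v (dim_vec c) \<longrightarrow> v \<bullet> (M *\<^sub>v v) > 0)"

text \<open>Only meaningful when \<open>cg_well_defined M c n\<close> holds.\<close>

definition cg_iterate :: "real mat \<Rightarrow> real vec \<Rightarrow> nat \<Rightarrow> real vec" where
  "cg_iterate M c n =
     the_minimizer (\<lambda>v. 1/2 * (v \<bullet> (M *\<^sub>v v)) - c \<bullet> v) (\<lambda>v. v \<in> krylov M c n)"


subsection \<open>Orthogonal polynomials and the vector \<open>\<sigma>\<close>\<close>

definition poly_ip :: "nat \<Rightarrow> (nat \<Rightarrow> real) \<Rightarrow> (nat \<Rightarrow> real) \<Rightarrow> real poly \<Rightarrow> real poly \<Rightarrow> real" where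
  "poly_ip d lam b p q = (\<Sum>i<d. (b i)\<^sup>2 * poly p (lam i) * poly q (lam i))"

definition poly_norm :: "nat \<Rightarrow> (nat \<Rightarrow> real) \<Rightarrow> (nat \<Rightarrow> real) \<Rightarrow> real poly \<Rightarrow> real" where
  "poly_norm d lam b p = sqrt (poly_ip d lam b p p)"

definition pi_poly :: "nat \<Rightarrow> (nat \<Rightarrow> real) \<Rightarrow> (nat \<Rightarrow> real) \<Rightarrow> nat \<Rightarrow> real poly" where
  "pi_poly d lam b n =
     the_minimizer (\<lambda>p. (poly_norm d lam b p)\<^sup>2)
       (\<lambda>p. Polynomial.degree p \<le> n \<and> Polynomial.coeff p n = 1)"

definition zeta_poly ::
    "nat \<Rightarrow> (nat \<Rightarrow> real) \<Rightarrow> (nat \<Rightarrow> real) \<Rightarrow> nat \<Rightarrow> nat \<Rightarrow> real poly" where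
  "zeta_poly d lam b j n =
     the_minimizer (\<lambda>p. (poly_norm d lam b p)\<^sup>2)
       (\<lambda>p. Polynomial.degree p \<le> n \<and> poly p (lam j) = 1)"

definition normalize_at_0 :: "real poly \<Rightarrow> real poly" where
  "normalize_at_0 p = Polynomial.smult (1 / poly p 0) p"

definition varsigma_poly ::
    "nat \<Rightarrow> (nat \<Rightarrow> real) \<Rightarrow> (nat \<Rightarrow> real) \<Rightarrow> nat \<Rightarrow> real poly" where
  "varsigma_poly d lam b n = normalize_at_0 (pi_poly d lam b n)"

definition xi_poly ::
    "nat \<Rightarrow> (nat \<Rightarrow> real) \<Rightarrow> (nat \<Rightarrow> real) \<Rightarrow> nat \<Rightarrow> nat \<Rightarrow> real poly" where
  "xi_poly d lam b j n = normalize_at_0 (zeta_poly d lam b j n)"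

text \<open>
  Row and column \<open>k < dt - d\<close> of the matrices below correspond to the global index \<open>d + k\<close>.
\<close>

definition sigma_vec ::
    "nat \<Rightarrow> nat \<Rightarrow> (nat \<Rightarrow> real) \<Rightarrow> (nat \<Rightarrow> real) \<Rightarrow> nat \<Rightarrow> real vec" where
  "sigma_vec d dt lam b n =
     (let m = dt - d;
          \<xi> = (\<lambda>j. xi_poly d lam b (d + j) (n - 1));
          B = mat_diag m (\<lambda>i. b (d + i));
          C = Matrix.mat m m (\<lambda>(i, j). poly (\<xi> j) (lam (d + i)));
          D = mat_diag m (\<lambda>j. (poly_norm d lam b (\<xi> j))\<^sup>2 / poly (\<xi> j) (lam (d + j)));
          w = Matrix.vec m (\<lambda>i. poly (varsigma_poly d lam b n) (lam (d + i)))
      in the (mat_inverse (D + B ^\<^sub>m 2 * C)) *\<^sub>v (B ^\<^sub>m 2 *\<^sub>v w))"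

end

theory Submission
  imports Defs "Jordan_Normal_Form.DL_Rank"
begin

text \<open>
  Write \<open>\<langle>p, q\<rangle>\<close> for the form given by the first \<open>d\<close> nodes and \<open>L\<close> for \<open>\<lambda>\<^sub>d\<close>. The \<open>m\<close>th residual polynomial
  is \<open>\<varsigma>\<^sub>m = 1 - x P\<^sub>m\<close>, where \<open>P\<^sub>m(A) b\<close> is the \<open>m\<close>th iterate; its roots are real and at least \<open>L\<close>, so that
  \<open>0 \<le> P\<^sub>m(x) \<le> (1 - (1 - x/L)\<^sup>m)/x\<close> for \<open>x < L\<close>. In the basis of residual polynomials the coefficients of
  \<open>P\<^sub>m\<close> are nonnegative and increase with \<open>m\<close>.

  Each \<open>\<xi>\<^sup>j\<close> is a reproducing kernel of the form, normalized at \<open>0\<close>, hence a convex combination of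
  \<open>\<varsigma>\<^sub>0, \<dots>, \<varsigma>\<^sub>n\<^sub>-\<^sub>1\<close>. The linear system for \<open>\<sigma>\<close> says that \<open>R = \<varsigma>\<^sub>n - \<Sum>\<^sub>j \<sigma>\<^sub>j \<xi>\<^sup>j\<close> is orthogonal to all polynomials
  of degree below \<open>n\<close> for the extended form. Writing \<open>R = \<varsigma>\<^sub>n - \<Sum>\<^sub>k \<tau>\<^sub>k \<varsigma>\<^sub>k\<close> with \<open>\<Sum>\<^sub>k \<bar>\<tau>\<^sub>k\<bar> \<le> \<parallel>\<sigma>\<parallel>\<^sub>1 < 1\<close>,
  \<open>R\<close> is positive on the nonpositive axis, so the smallest Ritz value of the extended problem is
  positive and CG is well defined; its residual polynomial is \<open>R / R(0)\<close>. Comparing \<open>P\<^sub>n\<close> with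
  \<open>(P\<^sub>n - \<Sum>\<^sub>k \<tau>\<^sub>k P\<^sub>k) / R(0)\<close> gives both estimates.
\<close>

section \<open>The bilinear form on polynomials\<close>

text \<open>Stated by coefficients so that the space has dimension \<open>n\<close> also for
  \<open>n = 0\<close>, where a degree bound cannot express that only the zero polynomial is left.
  Inductions on \<open>n\<close> then start from a trivial case.\<close>

definition polys_below :: "nat \<Rightarrow> real poly set" where
  "polys_below n = {p. \<forall>k\<ge>n. Polynomial.coeff p k = 0}"

lemma polys_below_iff_degree: "p \<in> polys_below n \<longleftrightarrow> p = 0 \<or> Polynomial.degree p < n"
proof
  assume p: "p \<in> polys_below n"
  show "p = 0 \<or> Polynomial.degree p < n"
  proof (rule ccontr)
    assume "\<not> ?thesis"
    then have "Polynomial.coeff p (Polynomial.degree p) = 0" "p \<noteq> 0"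
      using p by (auto simp: polys_below_def)
    then show False by simp
  qed
qed (auto simp: polys_below_def intro: coeff_eq_0)

lemma polys_below_Suc_iff: "p \<in> polys_below (Suc n) \<longleftrightarrow> Polynomial.degree p \<le> n"
  by (auto simp: polys_below_iff_degree)

lemma polys_below_0 [simp]: "p \<in> polys_below 0 \<longleftrightarrow> p = 0"
  by (auto simp: polys_below_iff_degree)

lemma polys_below_zero [simp]: "0 \<in> polys_below n"
  and polys_below_add: "p \<in> polys_below n \<Longrightarrow> q \<in> polys_below n \<Longrightarrow> p + q \<in> polys_below n"
  and polys_below_diff: "p \<in> polys_below n \<Longrightarrow> q \<in> polys_below n \<Longrightarrow> p - q \<in> polys_below n"
  and polys_below_smult: "p \<in> polys_below n \<Longrightarrow> Polynomial.smult c p \<in> polys_below n"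
  by (auto simp: polys_below_def)

lemma polys_below_sum: "(\<And>i. i \<in> I \<Longrightarrow> f i \<in> polys_below n) \<Longrightarrow> sum f I \<in> polys_below n"
  by (induction I rule: infinite_finite_induct) (auto intro: polys_below_add)

lemma polys_below_mono: "p \<in> polys_below m \<Longrightarrow> m \<le> n \<Longrightarrow> p \<in> polys_below n"
  by (auto simp: polys_below_def)

lemma polys_below_pCons: "p \<in> polys_below n \<Longrightarrow> pCons c p \<in> polys_below (Suc n)"
  by (auto simp: polys_below_def coeff_pCons split: nat.split)

lemma linear_factor_mult:
  fixes p :: "real poly"
  shows "[:- r, 1:] * p = pCons 0 p - Polynomial.smult r p"
  by simp

lemma polys_below_linear_mult: "p \<in> polys_below n \<Longrightarrow> [:- r, 1:] * p \<in> polys_below (Suc n)"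
  unfolding linear_factor_mult
  by (intro polys_below_diff polys_below_smult polys_below_pCons) (auto intro: polys_below_mono)

lemma coeff_linear_mult:
  "p \<in> polys_below (Suc n) \<Longrightarrow> Polynomial.coeff ([:- r, 1:] * p) (Suc n) = Polynomial.coeff p n"
  unfolding linear_factor_mult by (auto simp: polys_below_def)

lemma polys_below_root_factor:
  assumes "p \<in> polys_below (Suc n)" "poly p r = 0"
  obtains q where "q \<in> polys_below n" "p = [:- r, 1:] * q"
proof -
  obtain q where q: "p = [:- r, 1:] * q" using assms(2) by (auto simp: poly_eq_0_iff_dvd elim: dvdE)
  show thesis
  proof (cases "q = 0")
    case False
    then have "Polynomial.degree p = Suc (Polynomial.degree q)"
      unfolding q by (subst degree_mult_eq) auto
    then show thesis using that[OF _ q] assms(1) False by (auto simp: polys_below_iff_degree)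
  qed (use that[of 0] q in auto)
qed

lemma polys_below_decompose:
  assumes "p \<in> polys_below (Suc m)" "q \<in> polys_below (Suc m)" "Polynomial.coeff q m \<noteq> 0"
  shows "p - Polynomial.smult (Polynomial.coeff p m / Polynomial.coeff q m) q \<in> polys_below m"
  unfolding polys_below_def
proof (intro CollectI allI impI)
  fix k assume "m \<le> k"
  then show "Polynomial.coeff (p - Polynomial.smult
      (Polynomial.coeff p m / Polynomial.coeff q m) q) k = 0"
    using assms by (cases "k = m") (auto simp: polys_below_def)
qed

lemma poly_ip_commute: "poly_ip d lam b p q = poly_ip d lam b q p"
  by (simp add: poly_ip_def mult_ac)

lemma poly_ip_add_left: "poly_ip d lam b (p + q) r = poly_ip d lam b p r + poly_ip d lam b q r"
  and poly_ip_diff_left: "poly_ip d lam b (p - q) r = poly_ip d lam b p r - poly_ip d lam b q r"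
  and poly_ip_smult_left: "poly_ip d lam b (Polynomial.smult c p) r = c * poly_ip d lam b p r"
  and poly_ip_zero_left [simp]: "poly_ip d lam b 0 r = 0"
  by (simp_all add: poly_ip_def algebra_simps sum.distrib sum_subtractf sum_distrib_left)

lemma poly_ip_add_right: "poly_ip d lam b r (p + q) = poly_ip d lam b r p + poly_ip d lam b r q"
  and poly_ip_diff_right: "poly_ip d lam b r (p - q) = poly_ip d lam b r p - poly_ip d lam b r q"
  and poly_ip_smult_right: "poly_ip d lam b r (Polynomial.smult c p) = c * poly_ip d lam b r p"
  and poly_ip_zero_right [simp]: "poly_ip d lam b r 0 = 0"
  by (simp_all add: poly_ip_commute[of d lam b r] poly_ip_add_left poly_ip_diff_left
      poly_ip_smult_left)

lemma poly_ip_sum_left: "poly_ip d lam b (sum f I) r = (\<Sum>i\<in>I. poly_ip d lam b (f i) r)"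
  by (induction I rule: infinite_finite_induct) (auto simp: poly_ip_add_left)

lemma poly_ip_mult_swap: "poly_ip d lam b (r * p) q = poly_ip d lam b p (r * q)"
  by (simp add: poly_ip_def mult_ac)

lemma poly_ip_pCons_swap: "poly_ip d lam b (pCons 0 p) q = poly_ip d lam b p (pCons 0 q)"
  by (simp add: poly_ip_def mult_ac)

lemma poly_ip_nonneg: "0 \<le> poly_ip d lam b p p"
  by (auto simp: poly_ip_def mult.assoc intro!: sum_nonneg)

lemma poly_norm_sq: "(poly_norm d lam b p)\<^sup>2 = poly_ip d lam b p p"
  by (simp add: poly_norm_def poly_ip_nonneg)

lemmas poly_ip_linear = poly_ip_add_left poly_ip_diff_left poly_ip_smult_left
  poly_ip_add_right poly_ip_diff_right poly_ip_smult_right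

text \<open>Only squares of the weights enter the form, so \<open>lam i - r\<close> may be negative
  or zero; a linear factor shared by both arguments can be absorbed into the weights.\<close>

lemma poly_ip_linear_factor_weight:
  "poly_ip d lam (\<lambda>i. b i * (lam i - r)) p q = poly_ip d lam b ([:- r, 1:] * p) ([:- r, 1:] * q)"
  unfolding poly_ip_def by (rule sum.cong) (auto simp: power2_eq_square algebra_simps)

lemma poly_ip_pCons_ge:
  assumes "\<And>i. i < d \<Longrightarrow> L \<le> lam i"
  shows "L * poly_ip d lam b p p \<le> poly_ip d lam b (pCons 0 p) p"
  unfolding poly_ip_def sum_distrib_left
proof (rule sum_mono)
  fix i assume "i \<in> {..<d}"
  then have "L * ((b i)\<^sup>2 * (poly p (lam i))\<^sup>2) \<le> lam i * ((b i)\<^sup>2 * (poly p (lam i))\<^sup>2)"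
    using assms by (intro mult_right_mono) auto
  then show "L * ((b i)\<^sup>2 * poly p (lam i) * poly p (lam i))
    \<le> (b i)\<^sup>2 * poly (pCons 0 p) (lam i) * poly p (lam i)"
    by (simp add: power2_eq_square mult_ac)
qed

text \<open>For the diagonal problem this is the condition that \<open>n\<close> is at most the
  grade (\<open>le_krylov_grade_iff\<close>); the argument about polynomials uses the grade only in
  this form.\<close>

definition poly_ip_definite :: "nat \<Rightarrow> (nat \<Rightarrow> real) \<Rightarrow> (nat \<Rightarrow> real) \<Rightarrow> nat \<Rightarrow> bool" where
  "poly_ip_definite d lam b n \<longleftrightarrow> (\<forall>p\<in>polys_below n. poly_ip d lam b p p = 0 \<longrightarrow> p = 0)"

definition orth_below ::
    "nat \<Rightarrow> (nat \<Rightarrow> real) \<Rightarrow> (nat \<Rightarrow> real) \<Rightarrow> nat \<Rightarrow> real poly \<Rightarrow> bool" where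
  "orth_below d lam b n p \<longleftrightarrow> (\<forall>q\<in>polys_below n. poly_ip d lam b p q = 0)"

lemma poly_ip_definite_mono:
  "poly_ip_definite d lam b n \<Longrightarrow> m \<le> n \<Longrightarrow> poly_ip_definite d lam b m"
  by (auto simp: poly_ip_definite_def intro: polys_below_mono)

lemma poly_ip_pos:
  "poly_ip_definite d lam b n \<Longrightarrow> p \<in> polys_below n \<Longrightarrow> p \<noteq> 0 \<Longrightarrow> 0 < poly_ip d lam b p p"
  using poly_ip_nonneg[of d lam b p] by (force simp: poly_ip_definite_def)

lemma orth_belowD: "orth_below d lam b n p \<Longrightarrow> q \<in> polys_below n \<Longrightarrow> poly_ip d lam b p q = 0"
  by (auto simp: orth_below_def)

lemma poly_ip_definite_linear_factor_weight:
  assumes "poly_ip_definite d lam b (Suc n)"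
  shows "poly_ip_definite d lam (\<lambda>i. b i * (lam i - r)) n"
  unfolding poly_ip_definite_def poly_ip_linear_factor_weight
proof (intro ballI impI)
  fix p assume "p \<in> polys_below n" "poly_ip d lam b ([:- r, 1:] * p) ([:- r, 1:] * p) = 0"
  then have "[:- r, 1:] * p = 0"
    using assms polys_below_linear_mult[of p n r] unfolding poly_ip_definite_def by blast
  then show "p = 0" by (simp only: mult_eq_0_iff) auto
qed

text \<open>Gram-Schmidt: the residual \<open>p\<close> of the monomial of degree \<open>m\<close>
  is orthogonal to everything of lower degree, so the projection grows by the component of
  \<open>f\<close> along \<open>p\<close>.\<close>

lemma orth_projection_exists:
  assumes "poly_ip_definite d lam b n"
  shows "\<exists>g\<in>polys_below n. orth_below d lam b n (f - g)"
  using assms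
proof (induction n arbitrary: f)
  case 0
  then show ?case by (auto simp: orth_below_def)
next
  case (Suc m)
  note IH = Suc.IH[OF poly_ip_definite_mono[OF Suc.prems]]
  obtain h where h: "h \<in> polys_below m" "orth_below d lam b m (Polynomial.monom 1 m - h)"
    using IH by auto
  define p where "p = Polynomial.monom 1 m - h"
  have p: "p \<in> polys_below (Suc m)" "Polynomial.coeff p m = 1"
    using h(1) by (auto simp: p_def polys_below_def)
  then have "p \<noteq> 0" by auto
  then have pos: "poly_ip d lam b p p \<noteq> 0" using poly_ip_pos[OF Suc.prems p(1)] by simp
  obtain g where g: "g \<in> polys_below m" "orth_below d lam b m (f - g)" using IH by auto
  define a where "a = poly_ip d lam b f p / poly_ip d lam b p p"
  have "poly_ip d lam b p g = 0" using h(2) g(1) unfolding p_def by (rule orth_belowD)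
  then have gp: "poly_ip d lam b g p = 0" by (simp add: poly_ip_commute)
  have "orth_below d lam b (Suc m) (f - (g + Polynomial.smult a p))"
    unfolding orth_below_def
  proof
    fix q assume q: "q \<in> polys_below (Suc m)"
    define r where "r = q - Polynomial.smult (Polynomial.coeff q m) p"
    have r: "r \<in> polys_below m" using polys_below_decompose[OF q p(1)] p(2) by (simp add: r_def)
    have q_eq: "q = r + Polynomial.smult (Polynomial.coeff q m) p" by (simp add: r_def)
    have "poly_ip d lam b (f - g) r = 0" using orth_belowD[OF g(2) r] .
    moreover have "poly_ip d lam b p r = 0" using orth_belowD[OF h(2) r] by (simp add: p_def)
    ultimately show "poly_ip d lam b (f - (g + Polynomial.smult a p)) q = 0"
      using pos gp by (subst q_eq) (auto simp: poly_ip_linear a_def)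
  qed
  moreover have "g + Polynomial.smult a p \<in> polys_below (Suc m)"
    using g(1) p(1) by (intro polys_below_add polys_below_smult) (auto intro: polys_below_mono)
  ultimately show ?case by blast
qed

section \<open>Real roots of orthogonal polynomials\<close>

lemma poly_constant_sign:
  fixes p :: "real poly"
  assumes "\<And>x. poly p x \<noteq> 0"
  shows "(\<forall>x. 0 < poly p x) \<or> (\<forall>x. poly p x < 0)"
proof (rule ccontr)
  assume "\<not> ?thesis"
  then obtain x y where "poly p x < 0" "0 < poly p y"
    using assms by (meson linorder_neqE_linordered_idom)
  then show False
    using poly_IVT_pos[of x y p] poly_IVT_neg[of y x p] assms
    by (cases x y rule: linorder_cases) auto
qed

text \<open>Otherwise \<open>p\<close> has constant sign, and orthogonality to the constant 1 forces
  all weights to vanish, against definiteness on constants.\<close>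

lemma orth_poly_has_real_root:
  assumes "poly_ip_definite d lam b (Suc n)" "orth_below d lam b (Suc n) p"
  shows "\<exists>r. poly p r = 0"
proof (rule ccontr)
  assume "\<not> ?thesis"
  then have nz: "\<And>x. poly p x \<noteq> 0" by auto
  have one: "(1 :: real poly) \<in> polys_below (Suc n)" by (simp add: polys_below_Suc_iff)
  have 0: "(\<Sum>i<d. (b i)\<^sup>2 * poly p (lam i)) = 0"
    using orth_belowD[OF assms(2) one] by (simp add: poly_ip_def)
  have "\<forall>i<d. (b i)\<^sup>2 * poly p (lam i) = 0"
    using poly_constant_sign[of p]
  proof (rule disjE)
    assume "\<forall>x. 0 < poly p x"
    then show ?thesis using 0 sum_nonneg_eq_0_iff[of "{..<d}" "\<lambda>i. (b i)\<^sup>2 * poly p (lam i)"]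
      by (auto simp: less_imp_le)
  next
    assume "\<forall>x. poly p x < 0"
    moreover have "(\<Sum>i<d. (b i)\<^sup>2 * - poly p (lam i)) = 0" using 0 by (simp add: sum_negf)
    ultimately show ?thesis
      using sum_nonneg_eq_0_iff[of "{..<d}" "\<lambda>i. (b i)\<^sup>2 * - poly p (lam i)"]
      by (auto simp: less_imp_le mult_nonneg_nonpos)
  qed (use nz in auto)
  then have "\<forall>i<d. b i = 0" using nz by auto
  then have "poly_ip d lam b 1 1 = 0" by (simp add: poly_ip_def)
  then show False using assms(1) one by (auto simp: poly_ip_definite_def)
qed

text \<open>Dividing an orthogonal polynomial by one of its linear factors gives an orthogonal polynomial
  for the weights multiplied by the square of the factor; the proofs below are inductions along
  this step.\<close>

lemma orth_poly_linear_factor: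
  assumes def: "poly_ip_definite d lam b (Suc n)" and orth: "orth_below d lam b (Suc n) p"
    and p: "p \<in> polys_below (Suc (Suc n))" "Polynomial.coeff p (Suc n) \<noteq> 0"
  obtains r l where "p = [:- r, 1:] * l" "l \<in> polys_below (Suc n)"
    "Polynomial.coeff l n = Polynomial.coeff p (Suc n)" "poly l r \<noteq> 0"
    "orth_below d lam (\<lambda>i. b i * (lam i - r)) n l"
proof -
  obtain r where r: "poly p r = 0" using orth_poly_has_real_root[OF def orth] by auto
  obtain l where l: "l \<in> polys_below (Suc n)" "p = [:- r, 1:] * l"
    using polys_below_root_factor[OF p(1) r] .
  have coeff: "Polynomial.coeff l n = Polynomial.coeff p (Suc n)"
    using coeff_linear_mult[OF l(1)] l(2) by simp
  have orth': "orth_below d lam (\<lambda>i. b i * (lam i - r)) n l"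
    unfolding orth_below_def poly_ip_linear_factor_weight l(2)[symmetric]
    using orth_belowD[OF orth polys_below_linear_mult] by blast
  \<comment> \<open>The root \<open>r\<close> is simple: a second factor could be moved across the
    form, making <l, l> equal to <g, p>, which vanishes.\<close>
  have "poly l r \<noteq> 0"
  proof
    assume "poly l r = 0"
    then obtain g where g: "g \<in> polys_below n" "l = [:- r, 1:] * g"
      using polys_below_root_factor[OF l(1)] by blast
    have "poly_ip d lam b l l = poly_ip d lam b g p"
      unfolding l(2) by (simp only: g(2) poly_ip_mult_swap)
    also have "\<dots> = 0"
      using orth_belowD[OF orth polys_below_mono[OF g(1)]] by (simp add: poly_ip_commute)
    finally have "l = 0" using def l(1) by (auto simp: poly_ip_definite_def)
    then show False using coeff p(2) by simp
  qed
  then show thesis using that l coeff orth' by blast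
qed

text \<open>The root \<open>r\<close> is a Rayleigh quotient: orthogonality of p = (x - r) l to
  \<open>l\<close> gives <x l, l> = r <l, l>, and all nodes are at least \<open>L\<close>. The other
  roots are those of \<open>l\<close>, which is orthogonal for modified weights at the same
  nodes.\<close>

lemma orth_poly_roots_ge:
  assumes "poly_ip_definite d lam b n" "orth_below d lam b n p"
    "p \<in> polys_below (Suc n)" "Polynomial.coeff p n \<noteq> 0"
    and L: "\<And>i. i < d \<Longrightarrow> L \<le> lam i"
  shows "\<exists>rs. length rs = n \<and> (\<forall>r\<in>set rs. L \<le> r) \<and>
    p = Polynomial.smult (Polynomial.coeff p n) (\<Prod>r\<leftarrow>rs. [:- r, 1:])"
  using assms(1-4)
proof (induction n arbitrary: b p)
  case 0
  then have "Polynomial.degree p = 0" by (auto simp: polys_below_Suc_iff)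
  then show ?case by (auto elim: degree_eq_zeroE)
next
  case (Suc n)
  obtain r l where l: "p = [:- r, 1:] * l" "l \<in> polys_below (Suc n)"
    "Polynomial.coeff l n = Polynomial.coeff p (Suc n)"
    "orth_below d lam (\<lambda>i. b i * (lam i - r)) n l"
    using orth_poly_linear_factor[OF Suc.prems] by metis
  have "l \<noteq> 0" using l(3) Suc.prems(4) by auto
  have "L * poly_ip d lam b l l \<le> poly_ip d lam b (pCons 0 l) l"
    using L by (rule poly_ip_pCons_ge)
  also have "pCons 0 l = p + Polynomial.smult r l" unfolding l(1) linear_factor_mult by simp
  also have "poly_ip d lam b (p + Polynomial.smult r l) l = r * poly_ip d lam b l l"
    using orth_belowD[OF Suc.prems(2) l(2)] by (simp add: poly_ip_linear)
  finally have "L \<le> r" using poly_ip_pos[OF Suc.prems(1) l(2) \<open>l \<noteq> 0\<close>] by simp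
  moreover obtain rs where "length rs = n" "\<forall>r\<in>set rs. L \<le> r"
    and rs: "l = Polynomial.smult (Polynomial.coeff l n) (\<Prod>r\<leftarrow>rs. [:- r, 1:])"
    using Suc.IH[OF poly_ip_definite_linear_factor_weight[OF Suc.prems(1)] l(4) l(2)]
      l(3) Suc.prems(4) by auto
  moreover have "p = Polynomial.smult (Polynomial.coeff p (Suc n)) (\<Prod>r\<leftarrow>r#rs. [:- r, 1:])"
    by (subst l(1), subst rs) (simp only: l(3) list.map prod_list.Cons mult_smult_right)
  ultimately show ?case by (intro exI[of _ "r # rs"]) auto
qed

text \<open>The nodes may be negative here; positivity comes from the roots of \<open>R\<close>, the
  Ritz values. Split \<open>p\<close> into a multiple of l = R / (x - r) and a polynomial (x - r) g.
  The parts stay orthogonal when one is multiplied by x; the first contributes \<open>r\<close>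
  times a squared norm, the second the same expression for \<open>g\<close> with modified
  weights.\<close>

lemma poly_ip_pCons_pos:
  assumes "poly_ip_definite d lam b n" "orth_below d lam b n R"
    "R \<in> polys_below (Suc n)" "Polynomial.coeff R n \<noteq> 0"
    and "\<And>x. poly R x = 0 \<Longrightarrow> 0 < x"
    and "p \<in> polys_below n" "p \<noteq> 0"
  shows "0 < poly_ip d lam b (pCons 0 p) p"
  using assms
proof (induction n arbitrary: b p R)
  case 0
  then show ?case by simp
next
  case (Suc n)
  obtain r l where l: "R = [:- r, 1:] * l" "l \<in> polys_below (Suc n)"
    "Polynomial.coeff l n = Polynomial.coeff R (Suc n)" "poly l r \<noteq> 0"
    "orth_below d lam (\<lambda>i. b i * (lam i - r)) n l"
    using orth_poly_linear_factor[OF Suc.prems(1-4)] by metis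
  have r: "0 < r" using Suc.prems(5)[of r] l(1) by simp
  \<comment> \<open>This value makes \<open>q\<close> vanish at \<open>r\<close>; it exists because
    \<open>r\<close> is a simple root of \<open>R\<close>.\<close>
  define c where "c = poly p r / poly l r"
  define q where "q = p - Polynomial.smult c l"
  have q: "q \<in> polys_below (Suc n)" "poly q r = 0"
    using Suc.prems(6) l(2,4) by (auto simp: q_def c_def intro: polys_below_diff polys_below_smult)
  obtain g where g: "g \<in> polys_below n" "q = [:- r, 1:] * g"
    using polys_below_root_factor[OF q] .
  have p_eq: "p = Polynomial.smult c l + q" by (simp add: q_def)
  have xl: "pCons 0 l = R + Polynomial.smult r l" unfolding l(1) linear_factor_mult by simp
  have Rg: "poly_ip d lam b R g = 0" and Rl: "poly_ip d lam b R l = 0" and Rq: "poly_ip d lam b R q = 0"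
    using orth_belowD[OF Suc.prems(2)] polys_below_mono[OF g(1)] l(2) q(1) by auto
  have lq: "poly_ip d lam b l q = 0"
    using Rg unfolding g(2) l(1) by (simp only: poly_ip_mult_swap)
  have "poly_ip d lam b (pCons 0 p) p =
      c\<^sup>2 * poly_ip d lam b (pCons 0 l) l + 2 * c * poly_ip d lam b (pCons 0 l) q
      + poly_ip d lam b (pCons 0 q) q"
  proof -
    have "pCons 0 p = Polynomial.smult c (pCons 0 l) + pCons 0 q" by (simp add: p_eq)
    moreover have "poly_ip d lam b (pCons 0 q) l = poly_ip d lam b (pCons 0 l) q"
      using poly_ip_pCons_swap poly_ip_commute by metis
    ultimately show ?thesis
      by (simp only: p_eq poly_ip_linear) (simp add: power2_eq_square algebra_simps)
  qed
  also have "poly_ip d lam b (pCons 0 l) q = 0"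
    unfolding xl using Rq lq by (simp add: poly_ip_linear)
  also have "poly_ip d lam b (pCons 0 l) l = r * poly_ip d lam b l l"
    unfolding xl using Rl by (simp add: poly_ip_linear)
  also have "poly_ip d lam b (pCons 0 q) q =
      poly_ip d lam (\<lambda>i. b i * (lam i - r)) (pCons 0 g) g"
    unfolding poly_ip_linear_factor_weight g(2) by (simp only: mult_pCons_right smult_0_left add_0_left add_0)
  finally have eq: "poly_ip d lam b (pCons 0 p) p = c\<^sup>2 * (r * poly_ip d lam b l l)
    + poly_ip d lam (\<lambda>i. b i * (lam i - r)) (pCons 0 g) g" by simp
  have "Polynomial.coeff l n \<noteq> 0" using l(3) Suc.prems(4) by simp
  moreover have "0 < x" if "poly l x = 0" for x
    by (rule Suc.prems(5)) (simp add: l(1) that)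
  ultimately have g_pos: "0 < poly_ip d lam (\<lambda>i. b i * (lam i - r)) (pCons 0 g) g" if "g \<noteq> 0"
    using Suc.IH[OF poly_ip_definite_linear_factor_weight[OF Suc.prems(1)] l(5) l(2) _ _ g(1) that]
    by blast
  have "l \<noteq> 0" using l(4) by auto
  then have ll: "0 < poly_ip d lam b l l" by (rule poly_ip_pos[OF Suc.prems(1) l(2)])
  show ?case
  proof (cases "g = 0")
    case True
    then have "c \<noteq> 0" using p_eq g(2) Suc.prems(7) by auto
    then show ?thesis unfolding eq using True r ll by simp
  next
    case False
    then show ?thesis unfolding eq using g_pos r ll
      by (intro add_nonneg_pos mult_nonneg_nonneg) auto
  qed
qed

section \<open>Residual polynomials\<close>

text \<open>Adding a root \<open>r\<close> sends P to 1/r + (1 - x/r) P. The upper bound obeys this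
  recursion with \<open>L\<close> for \<open>r\<close>, and is written as a geometric sum so that x
  = 0 is no special case.\<close>

lemma root_product_bounds:
  fixes rs :: "real list"
  assumes L: "0 < L" and rs: "\<And>r. r \<in> set rs \<Longrightarrow> L \<le> r"
  shows "\<exists>P. (\<Prod>r\<leftarrow>rs. [:1, - 1 / r:]) = 1 - pCons 0 P \<and> P \<in> polys_below (length rs) \<and>
    (\<forall>x\<le>L. 0 \<le> poly P x \<and> poly P x \<le> (\<Sum>k<length rs. (1 - x / L) ^ k) / L) \<and>
    (\<forall>x<L. 0 < poly (\<Prod>r\<leftarrow>rs. [:1, - 1 / r:]) x)"
  using rs
proof (induction rs)
  case Nil
  then show ?case by (intro exI[of _ 0]) auto
next
  case (Cons r rs)
  have r: "L \<le> r" "0 < r" using Cons.prems[of r] L by auto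
  obtain P where P: "(\<Prod>r\<leftarrow>rs. [:1, - 1 / r:]) = 1 - pCons 0 P" "P \<in> polys_below (length rs)"
    "\<And>x. x \<le> L \<Longrightarrow> 0 \<le> poly P x"
    "\<And>x. x \<le> L \<Longrightarrow> poly P x \<le> (\<Sum>k<length rs. (1 - x / L) ^ k) / L"
    "\<And>x. x < L \<Longrightarrow> 0 < poly (\<Prod>r\<leftarrow>rs. [:1, - 1 / r:]) x"
    using Cons by auto
  define P' where "P' = [:1 / r:] + P - Polynomial.smult (1 / r) (pCons 0 P)"
  have poly_P': "poly P' x = 1 / r + (1 - x / r) * poly P x" for x
    by (simp add: P'_def algebra_simps)
  have 1: "(\<Prod>r\<leftarrow>r # rs. [:1, - 1 / r:]) = 1 - pCons 0 P'"
    by (simp only: list.map prod_list.Cons P(1))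
       (rule poly_ext, simp add: poly_P' algebra_simps)
  have "[:1 / r:] \<in> polys_below (Suc (length rs))" by (simp add: polys_below_Suc_iff)
  then have 2: "P' \<in> polys_below (length (r # rs))"
    unfolding P'_def list.size add_Suc_right add_0_right
    by (intro polys_below_add polys_below_diff polys_below_smult polys_below_pCons P(2)
        polys_below_mono[OF P(2)]) auto
  have 3: "0 \<le> poly P' x \<and> poly P' x \<le> (\<Sum>k<length (r # rs). (1 - x / L) ^ k) / L" if x: "x \<le> L" for x
  proof
    have xr: "0 \<le> 1 - x / r" and xL: "0 \<le> 1 - x / L" using x r L by (auto simp: divide_le_eq)
    show "0 \<le> poly P' x" unfolding poly_P' using P(3)[OF x] r xr by (intro add_nonneg_nonneg) auto
    define B where "B = (\<Sum>k<length rs. (1 - x / L) ^ k) / L"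
    have geom: "x / L * (\<Sum>k<length rs. (1 - x / L) ^ k) = 1 - (1 - x / L) ^ length rs"
      using one_diff_power_eq[of "1 - x / L" "length rs"] by simp
    have xB: "1 - x * B = (1 - x / L) ^ length rs" using geom by (simp add: B_def field_simps)
    have "(\<Sum>k<length (r # rs). (1 - x / L) ^ k) / L = 1 / L + (1 - x / L) * B"
      by (simp add: B_def sum.lessThan_Suc_shift sum_distrib_left add_divide_distrib del: sum.lessThan_Suc)
    moreover have "poly P' x \<le> 1 / r + (1 - x / r) * B"
      unfolding poly_P' B_def using P(4)[OF x] xr by (intro add_left_mono mult_left_mono)
    \<comment> \<open>Replacing \<open>r\<close> by \<open>L\<close> in 1/r + (1 - x/r) B changes it
      by exactly this product, whose second factor is a power of 1 - x/L.\<close>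
    moreover have "0 \<le> (1 / L - 1 / r) * (1 - x * B)"
      unfolding xB using L r xL by (intro mult_nonneg_nonneg zero_le_power) (auto intro: frac_le)
    ultimately show "poly P' x \<le> (\<Sum>k<length (r # rs). (1 - x / L) ^ k) / L"
      by (simp add: algebra_simps)
  qed
  have 4: "0 < poly (\<Prod>r\<leftarrow>r # rs. [:1, - 1 / r:]) x" if x: "x < L" for x
  proof -
    have "0 < 1 - x / r" using x r by (auto simp: divide_less_eq)
    then have "0 < (1 - x / r) * poly (\<Prod>r\<leftarrow>rs. [:1, - 1 / r:]) x"
      using P(5)[OF x] by (rule mult_pos_pos)
    then show ?thesis by (simp add: algebra_simps)
  qed
  show ?case using 1 2 3 4 by blast
qed

lemma root_product_normalize:
  fixes rs :: "real list"
  assumes "\<And>r. r \<in> set rs \<Longrightarrow> r \<noteq> 0"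
  shows "(\<Prod>r\<leftarrow>rs. [:- r, 1:]) = Polynomial.smult (poly (\<Prod>r\<leftarrow>rs. [:- r, 1:]) 0) (\<Prod>r\<leftarrow>rs. [:1, - 1 / r:])
    \<and> poly (\<Prod>r\<leftarrow>rs. [:- r, 1:]) 0 \<noteq> 0"
  using assms
proof (induction rs)
  case (Cons r rs)
  have r: "[:- r, 1:] = Polynomial.smult (- r) [:1, - 1 / r:]" using Cons.prems by simp
  have IH: "(\<Prod>r\<leftarrow>rs. [:- r, 1:]) = Polynomial.smult (poly (\<Prod>r\<leftarrow>rs. [:- r, 1:]) 0) (\<Prod>r\<leftarrow>rs. [:1, - 1 / r:])"
    and nz: "poly (\<Prod>r\<leftarrow>rs. [:- r, 1:]) 0 \<noteq> 0" using Cons by auto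
  have "(\<Prod>r\<leftarrow>r # rs. [:- r, 1:]) = Polynomial.smult (- r) [:1, - 1 / r:] *
      Polynomial.smult (poly (\<Prod>r\<leftarrow>rs. [:- r, 1:]) 0) (\<Prod>r\<leftarrow>rs. [:1, - 1 / r:])"
    using IH by (simp only: list.map prod_list.Cons r[symmetric] flip: IH)
  also have "\<dots> = Polynomial.smult (- r * poly (\<Prod>r\<leftarrow>rs. [:- r, 1:]) 0) (\<Prod>r\<leftarrow>r # rs. [:1, - 1 / r:])"
    by (simp only: list.map prod_list.Cons mult_smult_left mult_smult_right smult_smult mult.commute)
  also have "- r * poly (\<Prod>r\<leftarrow>rs. [:- r, 1:]) 0 = poly (\<Prod>r\<leftarrow>r # rs. [:- r, 1:]) 0" by simp
  finally show ?case by (rule conjI) (use nz Cons.prems in simp)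
qed simp

lemma orth_poly_normalized:
  assumes def: "poly_ip_definite d lam b n" and orth: "orth_below d lam b n p"
    and p: "p \<in> polys_below (Suc n)" "Polynomial.coeff p n \<noteq> 0"
    and L: "0 < L" "\<And>i. i < d \<Longrightarrow> L \<le> lam i"
  shows "\<exists>P\<in>polys_below n. normalize_at_0 p = 1 - pCons 0 P \<and>
    (\<forall>x\<le>L. 0 \<le> poly P x \<and> poly P x \<le> (\<Sum>k<n. (1 - x / L) ^ k) / L) \<and>
    (\<forall>x<L. 0 < poly (normalize_at_0 p) x) \<and> poly p 0 \<noteq> 0"
proof -
  obtain rs where rs: "length rs = n" "\<And>r. r \<in> set rs \<Longrightarrow> L \<le> r"
    and p_eq: "p = Polynomial.smult (Polynomial.coeff p n) (\<Prod>r\<leftarrow>rs. [:- r, 1:])"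
    using orth_poly_roots_ge[OF def orth p L(2)] by blast
  define f where "f = (\<Prod>r\<leftarrow>rs. [:- r, 1:])"
  define g where "g = (\<Prod>r\<leftarrow>rs. [:1, - 1 / r:])"
  have f: "f = Polynomial.smult (poly f 0) g" "poly f 0 \<noteq> 0"
    using root_product_normalize[of rs] rs(2) L(1) unfolding f_def g_def by force+
  have p0: "poly p 0 = Polynomial.coeff p n * poly f 0"
    using arg_cong[OF p_eq, of "\<lambda>q. poly q 0"] by (simp add: f_def)
  then have nz: "poly p 0 \<noteq> 0" using f(2) p(2) by simp
  have "p = Polynomial.smult (poly p 0) g"
    using p_eq f(1) p0 unfolding f_def[symmetric] by (metis smult_smult)
  then have "normalize_at_0 p = Polynomial.smult (1 / poly p 0) (Polynomial.smult (poly p 0) g)"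
    by (simp only: normalize_at_0_def)
  also have "\<dots> = g" using nz by simp
  finally have norm: "normalize_at_0 p = g" .
  show ?thesis using root_product_bounds[OF L(1), of rs, OF rs(2)] nz
    unfolding norm g_def[symmetric] rs(1) by blast
qed

lemma the_minimizer_eqI:
  assumes "P x" "\<And>y. P y \<Longrightarrow> y \<noteq> x \<Longrightarrow> f x < f y"
  shows "the_minimizer f P = x"
  unfolding the_minimizer_def is_arg_min_def
proof (rule the_equality)
  show "P x \<and> \<not> (\<exists>y. P y \<and> f y < f x)"
    using assms by (metis less_asym)
  show "y = x" if "P y \<and> \<not> (\<exists>z. P z \<and> f z < f y)" for y
    using assms that by metis
qed

text \<open>Two monic competitors differ by a polynomial of degree below \<open>n\<close>, so by
  Pythagoras the minimizer is the monomial minus its projection.\<close>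

lemma pi_poly_orth:
  assumes "poly_ip_definite d lam b n"
  shows "pi_poly d lam b n \<in> polys_below (Suc n)" "Polynomial.coeff (pi_poly d lam b n) n = 1"
    "orth_below d lam b n (pi_poly d lam b n)"
proof -
  obtain h where h: "h \<in> polys_below n" "orth_below d lam b n (Polynomial.monom 1 n - h)"
    using orth_projection_exists[OF assms] by blast
  define p where "p = Polynomial.monom 1 n - h"
  have p: "p \<in> polys_below (Suc n)" "Polynomial.coeff p n = 1"
    using h(1) by (auto simp: p_def polys_below_def)
  have "pi_poly d lam b n = p"
    unfolding pi_poly_def
  proof (rule the_minimizer_eqI)
    show "Polynomial.degree p \<le> n \<and> Polynomial.coeff p n = 1"
      using p by (simp add: polys_below_Suc_iff)
    fix y assume y: "Polynomial.degree y \<le> n \<and> Polynomial.coeff y n = 1" "y \<noteq> p"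
    have below: "y - p \<in> polys_below n"
      using polys_below_decompose[of y n p] y(1) p by (simp add: polys_below_Suc_iff)
    have "poly_ip d lam b p (y - p) = 0" using h(2) below unfolding p_def by (rule orth_belowD)
    moreover have "0 < poly_ip d lam b (y - p) (y - p)"
      using poly_ip_pos[OF assms below] y(2) by simp
    ultimately show "(poly_norm d lam b p)\<^sup>2 < (poly_norm d lam b y)\<^sup>2"
      unfolding poly_norm_sq by (simp add: poly_ip_linear poly_ip_commute[of d lam b y p])
  qed
  then show "pi_poly d lam b n \<in> polys_below (Suc n)" "Polynomial.coeff (pi_poly d lam b n) n = 1"
    "orth_below d lam b n (pi_poly d lam b n)" using p h(2) by (auto simp: p_def)
qed

section \<open>The Krylov polynomials of the original problem\<close>

locale definite_form =
  fixes d :: nat and lam b :: "nat \<Rightarrow> real" and n :: nat and L :: real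
  assumes definite: "poly_ip_definite d lam b n"
    and L_pos: "0 < L"
    and L_le: "\<And>i. i < d \<Longrightarrow> L \<le> lam i"
begin

abbreviation ip :: "real poly \<Rightarrow> real poly \<Rightarrow> real" where
  "ip \<equiv> poly_ip d lam b"

abbreviation res :: "nat \<Rightarrow> real poly" where
  "res \<equiv> varsigma_poly d lam b"

text \<open>The \<open>P\<^sub>m\<close> of the overview. For \<open>m \<le> n\<close> the division
  is exact, since \<open>res m\<close> is 1 at 0.\<close>

definition cg_poly :: "nat \<Rightarrow> real poly" where
  "cg_poly m = (1 - res m) div [:0, 1:]"

lemma res_cg_poly:
  assumes "m \<le> n"
  shows "res m = 1 - pCons 0 (cg_poly m)" "cg_poly m \<in> polys_below m"
    and "x \<le> L \<Longrightarrow> 0 \<le> poly (cg_poly m) x"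
    and "x \<le> L \<Longrightarrow> poly (cg_poly m) x \<le> (\<Sum>k<m. (1 - x / L) ^ k) / L"
    and "x < L \<Longrightarrow> 0 < poly (res m) x"
    and "res m \<in> polys_below (Suc m)" "Polynomial.coeff (res m) m \<noteq> 0" "orth_below d lam b m (res m)"
proof -
  note pi = pi_poly_orth[OF poly_ip_definite_mono[OF definite assms]]
  obtain P where P: "P \<in> polys_below m" "res m = 1 - pCons 0 P"
    "\<forall>x\<le>L. 0 \<le> poly P x \<and> poly P x \<le> (\<Sum>k<m. (1 - x / L) ^ k) / L"
    "\<forall>x<L. 0 < poly (res m) x" and nz: "poly (pi_poly d lam b m) 0 \<noteq> 0"
    using orth_poly_normalized[OF poly_ip_definite_mono[OF definite assms] pi(3,1) _ L_pos L_le] pi(2)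
    unfolding varsigma_poly_def by auto
  have "1 - res m = [:0, 1:] * P" unfolding P(2) by simp
  then have "cg_poly m = P" unfolding cg_poly_def
    by (metis nonzero_mult_div_cancel_left one_neq_zero pCons_eq_0_iff)
  with P show "res m = 1 - pCons 0 (cg_poly m)" "cg_poly m \<in> polys_below m"
    "x \<le> L \<Longrightarrow> 0 \<le> poly (cg_poly m) x"
    "x \<le> L \<Longrightarrow> poly (cg_poly m) x \<le> (\<Sum>k<m. (1 - x / L) ^ k) / L"
    "x < L \<Longrightarrow> 0 < poly (res m) x" by auto
  show "res m \<in> polys_below (Suc m)" "Polynomial.coeff (res m) m \<noteq> 0" "orth_below d lam b m (res m)"
    using pi nz unfolding varsigma_poly_def normalize_at_0_def
    by (auto simp: orth_below_def poly_ip_smult_left intro: polys_below_smult)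
qed

lemma res_at_0: "m \<le> n \<Longrightarrow> poly (res m) 0 = 1"
  by (simp add: res_cg_poly(1))

lemma ip_res_pos: "m < n \<Longrightarrow> 0 < ip (res m) (res m)"
  using res_cg_poly(6,7)[of m]
  by (intro poly_ip_pos[OF definite]) (auto intro: polys_below_mono)

lemma ip_res_res: "k < n \<Longrightarrow> m < n \<Longrightarrow> k \<noteq> m \<Longrightarrow> ip (res k) (res m) = 0"
proof (induction k m rule: linorder_wlog)
  case (le k m)
  then have "ip (res m) (res k) = 0"
    using orth_belowD[OF res_cg_poly(8)] polys_below_mono[OF res_cg_poly(6)] by simp
  then show ?case by (simp add: poly_ip_commute)
qed (auto simp: poly_ip_commute)

lemma orth_to_res_imp_zero:
  assumes "m \<le> n" "p \<in> polys_below m" "\<And>k. k < m \<Longrightarrow> ip p (res k) = 0"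
  shows "p = 0"
proof -
  have "ip p q = 0" if "j \<le> m" "q \<in> polys_below j" for q j
    using that
  proof (induction j arbitrary: q)
    case (Suc j)
    have j: "j \<le> n" using Suc.prems assms(1) by simp
    define q' where "q' = q - Polynomial.smult (Polynomial.coeff q j / Polynomial.coeff (res j) j) (res j)"
    have "q' \<in> polys_below j"
      using polys_below_decompose[OF Suc.prems(2) res_cg_poly(6,7)[OF j]] by (simp add: q'_def)
    then have "ip p q' = 0" using Suc by simp
    then show ?case using assms(3)[of j] Suc.prems(1) by (simp add: q'_def poly_ip_linear)
  qed simp
  then have "ip p p = 0" using assms(2) by blast
  then show ?thesis using definite polys_below_mono[OF assms(2,1)] by (auto simp: poly_ip_definite_def)
qed

lemma ip_sum_res:
  assumes "m \<le> n" "k < n"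
  shows "ip (\<Sum>j<m. Polynomial.smult (c j) (res j)) (res k) = (if k < m then c k * ip (res k) (res k) else 0)"
proof -
  have "ip (\<Sum>j<m. Polynomial.smult (c j) (res j)) (res k) =
      (\<Sum>j<m. if j = k then c k * ip (res k) (res k) else 0)"
    unfolding poly_ip_sum_left using assms by (intro sum.cong) (auto simp: poly_ip_smult_left ip_res_res)
  then show ?thesis by simp
qed

lemma res_expansion:
  assumes "m \<le> n" "p \<in> polys_below m"
  shows "p = (\<Sum>k<m. Polynomial.smult (ip p (res k) / ip (res k) (res k)) (res k))"
proof -
  define s where "s = (\<Sum>k<m. Polynomial.smult (ip p (res k) / ip (res k) (res k)) (res k))"
  have "s \<in> polys_below m" unfolding s_def using assms(1)
    by (intro polys_below_sum polys_below_smult) (auto intro!: polys_below_mono[OF res_cg_poly(6)])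
  then have "p - s \<in> polys_below m" using assms(2) by (rule polys_below_diff[rotated])
  moreover have "ip (p - s) (res k) = 0" if "k < m" for k
    using ip_sum_res[OF assms(1), of k] that assms(1) ip_res_pos[of k]
    by (simp add: poly_ip_diff_left s_def)
  ultimately show ?thesis using orth_to_res_imp_zero[OF assms(1), of "p - s"] by (simp add: s_def)
qed

lemma ip_sum_res_sq:
  "ip (\<Sum>j<n. Polynomial.smult (c j) (res j)) (\<Sum>j<n. Polynomial.smult (c j) (res j)) =
    (\<Sum>k<n. (c k)\<^sup>2 * ip (res k) (res k))"
  (is "ip ?s ?s = _")
proof -
  have "ip ?s ?s = (\<Sum>k<n. c k * ip ?s (res k))"
    by (subst poly_ip_commute, subst poly_ip_sum_left)
       (simp add: poly_ip_smult_left poly_ip_commute[of _ _ _ "res _" ?s])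
  also have "\<dots> = (\<Sum>k<n. (c k)\<^sup>2 * ip (res k) (res k))"
    by (intro sum.cong) (simp_all add: ip_sum_res power2_eq_square)
  finally show ?thesis .
qed

text \<open>The form with weights \<open>b\<^sub>i\<^sup>2 / \<lambda>\<^sub>i\<close>: the residual polynomials are the minimizers of this
  energy, and the expansion of \<open>cg_poly\<close> in residual polynomials has energy differences as
  coefficients.\<close>

abbreviation ien :: "real poly \<Rightarrow> real poly \<Rightarrow> real" where
  "ien \<equiv> poly_ip d lam (\<lambda>i. b i / sqrt (lam i))"

definition energy :: "nat \<Rightarrow> real" where
  "energy k = ien (res k) 1"

lemma ien_pCons: "ien (pCons 0 p) q = ip p q"
  unfolding poly_ip_def
proof (rule sum.cong)
  fix i assume "i \<in> {..<d}"
  then have "0 < lam i" using L_le L_pos by force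
  then show "(b i / sqrt (lam i))\<^sup>2 * poly (pCons 0 p) (lam i) * poly q (lam i) =
      (b i)\<^sup>2 * poly p (lam i) * poly q (lam i)"
    by (simp add: power_divide)
qed simp

text \<open>Write \<open>res k\<close> as 1 minus x times \<open>cg_poly k\<close>. The factor x
  cancels the weight \<open>1 / lam i\<close>, leaving <res m, cg_poly k>, which is 0 because
  \<open>cg_poly k\<close> has degree below \<open>k \<le> m\<close>.\<close>

lemma ien_res_res:
  assumes "k \<le> m" "m \<le> n"
  shows "ien (res m) (res k) = energy m"
proof -
  have "ien (res m) (res k) = energy m - ien (res m) (pCons 0 (cg_poly k))"
    unfolding energy_def using assms by (subst (2) res_cg_poly(1)) (simp_all add: poly_ip_diff_right)
  also have "ien (res m) (pCons 0 (cg_poly k)) = ip (res m) (cg_poly k)"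
    by (metis ien_pCons poly_ip_commute)
  also have "\<dots> = 0"
    using assms orth_belowD[OF res_cg_poly(8)] polys_below_mono[OF res_cg_poly(2)] by simp
  finally show ?thesis by simp
qed

text \<open>The difference \<open>energy k - energy m\<close> is the squared energy norm of
  \<open>res k - res m\<close>.\<close>

lemma energy_antimono: "k \<le> m \<Longrightarrow> m \<le> n \<Longrightarrow> energy m \<le> energy k"
  using poly_ip_nonneg[of d lam "\<lambda>i. b i / sqrt (lam i)" "res k - res m"]
    ien_res_res[of k m] ien_res_res[of m m] ien_res_res[of k k]
    poly_ip_commute[of d lam "\<lambda>i. b i / sqrt (lam i)" "res k" "res m"]
  by (simp add: poly_ip_linear)

lemma cg_poly_expansion:
  assumes "m \<le> n"
  shows "cg_poly m = (\<Sum>k<m. Polynomial.smult ((energy k - energy m) / ip (res k) (res k)) (res k))"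
proof -
  have "ip (cg_poly m) (res k) = energy k - energy m" if "k < m" for k
  proof -
    have "ip (cg_poly m) (res k) = ien (1 - res m) (res k)"
      unfolding ien_pCons[symmetric] using res_cg_poly(1)[OF assms] by simp
    also have "\<dots> = energy k - energy m"
      using ien_res_res[of k m] that assms by (simp add: poly_ip_linear energy_def poly_ip_commute)
    finally show ?thesis .
  qed
  then show ?thesis using res_expansion[OF assms res_cg_poly(2)[OF assms]] by simp
qed

definition cg_coeff :: "nat \<Rightarrow> real" where
  "cg_coeff k = (energy k - energy n) / ip (res k) (res k)"

lemma cg_poly_n_expansion: "cg_poly n = (\<Sum>k<n. Polynomial.smult (cg_coeff k) (res k))"
  using cg_poly_expansion[of n] by (simp add: cg_coeff_def)

text \<open>The coefficients of \<open>cg_poly m\<close> grow with \<open>m\<close> because the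
  energy decreases. This gives both the pointwise comparison left of \<open>L\<close> and the norm
  comparison in \<open>ext_poly_diff_norm\<close>.\<close>

lemma cg_poly_diff_expansion:
  assumes "m \<le> n"
  obtains c where "cg_poly n - cg_poly m = (\<Sum>k<n. Polynomial.smult (c k) (res k))"
    "\<And>k. k < n \<Longrightarrow> 0 \<le> c k \<and> c k \<le> cg_coeff k"
proof
  \<comment> \<open>Coefficients of \<open>cg_poly m\<close>, padded by 0 from index
    \<open>m\<close> on.\<close>
  define e where "e = (\<lambda>k. if k < m then (energy k - energy m) / ip (res k) (res k) else 0)"
  have "cg_poly m = (\<Sum>k<n. Polynomial.smult (e k) (res k))"
    unfolding cg_poly_expansion[OF assms] e_def using assms
    by (intro sum.mono_neutral_cong_left) auto
  then show "cg_poly n - cg_poly m = (\<Sum>k<n. Polynomial.smult (cg_coeff k - e k) (res k))"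
    by (simp add: cg_poly_n_expansion sum_subtractf smult_diff_left)
  fix k assume k: "k < n"
  then have "energy n \<le> energy k" "energy n \<le> energy m" "k < m \<Longrightarrow> energy m \<le> energy k"
    using energy_antimono assms by auto
  then show "0 \<le> cg_coeff k - e k \<and> cg_coeff k - e k \<le> cg_coeff k"
    using ip_res_pos[OF k] by (auto simp: cg_coeff_def e_def divide_right_mono less_imp_le)
qed

lemma cg_poly_mono:
  assumes "m \<le> n" "x < L"
  shows "poly (cg_poly m) x \<le> poly (cg_poly n) x"
proof -
  obtain c where c: "cg_poly n - cg_poly m = (\<Sum>k<n. Polynomial.smult (c k) (res k))"
    "\<And>k. k < n \<Longrightarrow> 0 \<le> c k \<and> c k \<le> cg_coeff k"
    using cg_poly_diff_expansion[OF assms(1)] by metis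
  have "0 \<le> poly (res k) x" if "k < n" for k using res_cg_poly(5)[of k x] that assms(2) by simp
  then have "0 \<le> poly (cg_poly n - cg_poly m) x"
    unfolding c(1) poly_sum using c(2) by (intro sum_nonneg) auto
  then show ?thesis by simp
qed

text \<open>For \<open>x \<le> 0\<close> the factor \<open>- x\<close> preserves the order of the
  values of \<open>cg_poly\<close>.\<close>

lemma res_antimono:
  assumes "m \<le> n" "x \<le> 0"
  shows "poly (res m) x \<le> poly (res n) x"
  using cg_poly_mono[OF assms(1), of x] assms L_pos
  by (simp add: res_cg_poly(1)) (rule mult_left_mono_neg)

end

section \<open>Reproducing kernels and the polynomials \<open>xi_poly\<close>\<close>

context definite_form
begin

text \<open>The Christoffel-Darboux kernel with one argument fixed at \<open>y\<close>, written in
  the orthogonal basis \<open>res k\<close>; it represents evaluation at \<open>y\<close>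
  (\<open>ip_kern\<close>).\<close>

definition kern :: "real \<Rightarrow> real poly" where
  "kern y = (\<Sum>k<n. Polynomial.smult (poly (res k) y / ip (res k) (res k)) (res k))"

lemma kern_below: "kern y \<in> polys_below n"
  unfolding kern_def
  by (intro polys_below_sum polys_below_smult) (auto intro!: polys_below_mono[OF res_cg_poly(6)])

lemma ip_kern:
  assumes "q \<in> polys_below n"
  shows "ip (kern y) q = poly q y"
proof -
  have "poly q y = (\<Sum>k<n. ip q (res k) / ip (res k) (res k) * poly (res k) y)"
    by (subst res_expansion[OF _ assms]) (simp_all add: poly_sum)
  then show ?thesis
    by (simp add: kern_def poly_ip_sum_left poly_ip_smult_left poly_ip_commute[of _ _ _ q] mult_ac)
qed

lemma poly_kern_pos:
  assumes "1 \<le> n" "y < L" "z < L"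
  shows "0 < poly (kern y) z"
  unfolding kern_def poly_sum poly_smult
proof (intro sum_pos)
  show "0 < poly (res k) y / ip (res k) (res k) * poly (res k) z" if "k \<in> {..<n}" for k
    using that assms res_cg_poly(5)[of k y] res_cg_poly(5)[of k z] ip_res_pos[of k] by simp
qed (use assms in \<open>auto simp: lessThan_empty_iff\<close>)

text \<open>Feasible polynomials differ by one that vanishes at \<open>lam j\<close>, and the kernel
  is orthogonal to these. With \<open>1 \<le> n\<close>, degree at most \<open>n - 1\<close> is the
  same as membership in \<open>polys_below n\<close>.\<close>

lemma zeta_poly_eq_kern:
  assumes "1 \<le> n" "lam j < L"
  shows "zeta_poly d lam b j (n - 1) =
    Polynomial.smult (1 / poly (kern (lam j)) (lam j)) (kern (lam j))"
    (is "_ = ?z")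
  unfolding zeta_poly_def
proof (rule the_minimizer_eqI)
  have pos: "0 < poly (kern (lam j)) (lam j)" using poly_kern_pos assms by simp
  have deg: "Polynomial.degree p \<le> n - 1 \<longleftrightarrow> p \<in> polys_below n" for p
    using polys_below_Suc_iff[of p "n - 1"] assms(1) by simp
  have z_below: "?z \<in> polys_below n" by (intro polys_below_smult kern_below)
  show "Polynomial.degree ?z \<le> n - 1 \<and> poly ?z (lam j) = 1"
    unfolding deg using z_below pos by simp
  fix y assume y: "Polynomial.degree y \<le> n - 1 \<and> poly y (lam j) = 1" "y \<noteq> ?z"
  have below: "y - ?z \<in> polys_below n" using y(1) z_below unfolding deg by (auto intro: polys_below_diff)
  have "ip ?z (y - ?z) = 0"
    using ip_kern[OF below] y(1) pos by (simp add: poly_ip_smult_left)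
  moreover have "0 < ip (y - ?z) (y - ?z)"
    using poly_ip_pos[OF definite below] y(2) by simp
  ultimately show "(poly_norm d lam b ?z)\<^sup>2 < (poly_norm d lam b y)\<^sup>2"
    unfolding poly_norm_sq by (simp add: poly_ip_diff_left poly_ip_diff_right poly_ip_commute[of d lam b y ?z])
qed

text \<open>The second identity simplifies the diagonal entries of \<open>D\<close>; it holds
  because the squared norm of a kernel is its value at its own point.\<close>

lemma xi_poly_eq_kern:
  assumes "1 \<le> n" "lam j < L"
  shows "xi_poly d lam b j (n - 1) = Polynomial.smult (1 / poly (kern (lam j)) 0) (kern (lam j))"
    and "(poly_norm d lam b (xi_poly d lam b j (n - 1)))\<^sup>2 / poly (xi_poly d lam b j (n - 1)) (lam j)
      = 1 / poly (kern (lam j)) 0"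
proof -
  have pos: "0 < poly (kern (lam j)) (lam j)" "0 < poly (kern (lam j)) 0"
    using poly_kern_pos assms L_pos by simp_all
  then show xi: "xi_poly d lam b j (n - 1) =
      Polynomial.smult (1 / poly (kern (lam j)) 0) (kern (lam j))"
    unfolding xi_poly_def normalize_at_0_def zeta_poly_eq_kern[OF assms] by simp
  show "(poly_norm d lam b (xi_poly d lam b j (n - 1)))\<^sup>2 / poly (xi_poly d lam b j (n - 1)) (lam j)
      = 1 / poly (kern (lam j)) 0"
    unfolding xi poly_norm_sq using pos
    by (simp add: poly_ip_smult_left poly_ip_smult_right ip_kern[OF kern_below])
qed

end

section \<open>Diagonal matrices and inverting the linear system\<close>

lemma mat_diag_power:
  fixes f :: "nat \<Rightarrow> 'a :: comm_semiring_1"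
  shows "mat_diag m f ^\<^sub>m k = mat_diag m (\<lambda>i. f i ^ k)"
proof (induction k)
  case (Suc k)
  then show ?case by (simp add: mult.commute)
qed (auto simp: mat_diag_def)

lemma mat_diag_mult_vec:
  fixes f :: "nat \<Rightarrow> 'a :: comm_semiring_1"
  assumes "v \<in> carrier_vec m"
  shows "mat_diag m f *\<^sub>v v = Matrix.vec m (\<lambda>i. f i * v $ i)"
proof (rule eq_vecI)
  fix i assume "i < dim_vec (Matrix.vec m (\<lambda>i. f i * v $ i))"
  then have i: "i < m" by simp
  have "(mat_diag m f *\<^sub>v v) $ i = (\<Sum>j<m. (if i = j then f j else 0) * v $ j)"
    using i assms by (simp add: mat_diag_def scalar_prod_def atLeast0LessThan)
  also have "\<dots> = (\<Sum>j<m. if j = i then f i * v $ i else 0)"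
    by (rule sum.cong) auto
  finally have "(mat_diag m f *\<^sub>v v) $ i = (\<Sum>j<m. if j = i then f i * v $ i else 0)" .
  then show "(mat_diag m f *\<^sub>v v) $ i = Matrix.vec m (\<lambda>i. f i * v $ i) $ i" using i by simp
qed (simp add: mat_diag_def)

text \<open>\<open>mat_inverse\<close> returns an option; a trivial null space gives a nonzero
  determinant and hence an actual inverse, so that \<open>the\<close> is meaningful.\<close>

lemma mat_inverse_mult_vec:
  fixes M :: "'a :: field mat"
  assumes M: "M \<in> carrier_mat m m" and r: "r \<in> carrier_vec m"
    and inj: "\<And>u. u \<in> carrier_vec m \<Longrightarrow> M *\<^sub>v u = 0\<^sub>v m \<Longrightarrow> u = 0\<^sub>v m"
  shows "the (mat_inverse M) *\<^sub>v r \<in> carrier_vec m" "M *\<^sub>v (the (mat_inverse M) *\<^sub>v r) = r"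
proof -
  have "Determinant.det M \<noteq> 0" using det_0_iff_vec_prod_zero_field[OF M] inj by blast
  then have "M \<in> Units (ring_mat TYPE('a) m ())" by (rule det_non_zero_imp_unit[OF M])
  then obtain N where "mat_inverse M = Some N" using mat_inverse(1)[OF M, where b = "()"] by (cases "mat_inverse M") auto
  then have N: "M * N = 1\<^sub>m m" "N \<in> carrier_mat m m" "the (mat_inverse M) = N"
    using mat_inverse(2)[OF M] by auto
  then show "the (mat_inverse M) *\<^sub>v r \<in> carrier_vec m" "M *\<^sub>v (the (mat_inverse M) *\<^sub>v r) = r"
    using r M by (auto simp flip: assoc_mult_mat_vec)
qed

section \<open>The residual polynomial of the extended problem\<close>

locale extended_form = definite_form +
  fixes dt :: nat
  assumes d_le_dt: "d \<le> dt" and n_pos: "1 \<le> n"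
    and lam_ext: "\<And>i. d \<le> i \<Longrightarrow> i < dt \<Longrightarrow> lam i < L"
begin

abbreviation ipt :: "real poly \<Rightarrow> real poly \<Rightarrow> real" where
  "ipt \<equiv> poly_ip dt lam b"

definition y :: "nat \<Rightarrow> real" where
  "y j = lam (d + j)"

text \<open>The normalizing constant: \<open>\<xi>\<close> for index \<open>j\<close> is
  \<open>kern (y j)\<close> divided by \<open>c0 j\<close>. Thus the sum subtracted in
  \<open>R\<close> below is the sum of the products of \<open>\<sigma>\<close> and
  \<open>\<xi>\<close>.\<close>

definition c0 :: "nat \<Rightarrow> real" where
  "c0 j = poly (kern (y j)) 0"

definition sg :: "nat \<Rightarrow> real" where
  "sg j = sigma_vec d dt lam b n $ j"

definition S :: real where
  "S = l1_norm (sigma_vec d dt lam b n)"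

lemma y_less: "j < dt - d \<Longrightarrow> y j < L"
  unfolding y_def by (rule lam_ext) auto

lemma c0_pos: "j < dt - d \<Longrightarrow> 0 < c0 j"
  unfolding c0_def using poly_kern_pos n_pos y_less L_pos by simp

definition R :: "real poly" where
  "R = res n - (\<Sum>j<dt - d. Polynomial.smult (sg j / c0 j) (kern (y j)))"

text \<open>Let \<open>g\<close> be the combination of kernels with coefficients \<open>v\<close>.
  The reproducing property and the equations write <g, g> as minus a sum of squares, so that sum
  vanishes, and with it each \<open>v i\<close>.\<close>

lemma sigma_system_injective:
  assumes "\<And>i. i < dt - d \<Longrightarrow>
    v i + (b (d + i))\<^sup>2 * (\<Sum>j<dt - d. v j * poly (kern (y j)) (y i)) = 0"
    and "i < dt - d"
  shows "v i = 0"
proof -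
  define g where "g = (\<Sum>j<dt - d. Polynomial.smult (v j) (kern (y j)))"
  have g: "g \<in> polys_below n" unfolding g_def by (intro polys_below_sum polys_below_smult kern_below)
  have v_eq: "v i = - (b (d + i))\<^sup>2 * poly g (y i)" if "i < dt - d" for i
    using assms(1)[OF that] by (simp add: g_def poly_sum)
  have "0 \<le> ip g g" by (rule poly_ip_nonneg)
  also have "ip g g = (\<Sum>j<dt - d. v j * poly g (y j))"
    by (subst (1) g_def) (simp add: poly_ip_sum_left poly_ip_smult_left ip_kern[OF g])
  also have "\<dots> = - (\<Sum>j<dt - d. (b (d + j) * poly g (y j))\<^sup>2)"
    unfolding sum_negf[symmetric]
    by (intro sum.cong) (auto simp: v_eq power2_eq_square)
  finally have "(\<Sum>j<dt - d. (b (d + j) * poly g (y j))\<^sup>2) = 0"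
    by (intro antisym sum_nonneg) auto
  then have "b (d + i) * poly g (y i) = 0"
    using assms(2) by (subst (asm) sum_nonneg_eq_0_iff) auto
  then show "v i = 0" using v_eq[OF assms(2)] by auto
qed

text \<open>Row \<open>i\<close> of the system turns into this equation once kernels replace
  \<open>\<xi>\<close>: the sum over \<open>j\<close> in the row is then \<open>res n - R\<close> at
  \<open>y i\<close>.\<close>

lemma sigma_equations:
  shows "dim_vec (sigma_vec d dt lam b n) = dt - d"
    and "i < dt - d \<Longrightarrow> sg i / c0 i = (b (d + i))\<^sup>2 * poly R (y i)"
proof -
  define m where "m = dt - d"
  define M where "M = Matrix.mat m m (\<lambda>(i, j). (if i = j then 1 / c0 j else 0) +
    (b (d + i))\<^sup>2 * (poly (kern (y j)) (y i) / c0 j))"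
  define w where "w = Matrix.vec m (\<lambda>i. (b (d + i))\<^sup>2 * poly (res n) (y i))"
  have xi: "xi_poly d lam b (d + j) (n - 1) = Polynomial.smult (1 / c0 j) (kern (y j))"
    "(poly_norm d lam b (xi_poly d lam b (d + j) (n - 1)))\<^sup>2 /
      poly (xi_poly d lam b (d + j) (n - 1)) (lam (d + j)) = 1 / c0 j" if "j < m" for j
    using xi_poly_eq_kern[OF n_pos] y_less[of j] that by (simp_all add: c0_def y_def m_def)
  have "mat_diag m (\<lambda>j. (poly_norm d lam b (xi_poly d lam b (d + j) (n - 1)))\<^sup>2 /
        poly (xi_poly d lam b (d + j) (n - 1)) (lam (d + j))) = mat_diag m (\<lambda>j. 1 / c0 j)"
    by (rule eq_matI) (auto simp: mat_diag_def xi(2) simp del: One_nat_def)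
  moreover have "Matrix.mat m m (\<lambda>(i, j). poly (xi_poly d lam b (d + j) (n - 1)) (lam (d + i))) =
      Matrix.mat m m (\<lambda>(i, j). poly (kern (y j)) (y i) / c0 j)"
    by (rule eq_matI) (auto simp: xi(1) y_def[of "_ :: nat"] simp del: One_nat_def)
  moreover have "mat_diag m (\<lambda>j. 1 / c0 j) + mat_diag m (\<lambda>i. b (d + i)) ^\<^sub>m 2 *
        Matrix.mat m m (\<lambda>(i, j). poly (kern (y j)) (y i) / c0 j) = M"
    unfolding mat_diag_power M_def
    by (subst mat_diag_mult_left[where nr = m], simp, rule eq_matI) (auto simp: mat_diag_def)
  ultimately have M_eq: "mat_diag m (\<lambda>j. (poly_norm d lam b (xi_poly d lam b (d + j) (n - 1)))\<^sup>2 /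
        poly (xi_poly d lam b (d + j) (n - 1)) (lam (d + j)))
      + mat_diag m (\<lambda>i. b (d + i)) ^\<^sub>m 2 *
        Matrix.mat m m (\<lambda>(i, j). poly (xi_poly d lam b (d + j) (n - 1)) (lam (d + i))) = M"
    by (simp only:)
  have w_eq: "mat_diag m (\<lambda>i. b (d + i)) ^\<^sub>m 2 *\<^sub>v
      Matrix.vec m (\<lambda>i. poly (varsigma_poly d lam b n) (lam (d + i))) = w"
    unfolding mat_diag_power w_def
    by (subst mat_diag_mult_vec) (auto simp: y_def)
  have sigma: "sigma_vec d dt lam b n = the (mat_inverse M) *\<^sub>v w"
    unfolding sigma_vec_def Let_def m_def[symmetric] M_eq w_eq ..
  have M: "M \<in> carrier_mat m m" and w: "w \<in> carrier_vec m" by (simp_all add: M_def w_def)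
  have M_mult: "(M *\<^sub>v u) $ i = u $ i / c0 i +
      (b (d + i))\<^sup>2 * (\<Sum>j<m. u $ j / c0 j * poly (kern (y j)) (y i))"
    if "u \<in> carrier_vec m" "i < m" for u i
  proof -
    have "(M *\<^sub>v u) $ i = (\<Sum>j<m. ((if i = j then 1 / c0 j else 0) +
        (b (d + i))\<^sup>2 * (poly (kern (y j)) (y i) / c0 j)) * u $ j)"
      using that by (simp add: M_def scalar_prod_def atLeast0LessThan)
    also have "\<dots> = (\<Sum>j<m. (if i = j then u $ i / c0 i else 0) +
        (b (d + i))\<^sup>2 * (u $ j / c0 j * poly (kern (y j)) (y i)))"
      by (intro sum.cong) (auto simp: algebra_simps)
    finally show ?thesis using that by (simp add: sum.distrib sum_distrib_left)
  qed
  have inj: "u = 0\<^sub>v m" if u: "u \<in> carrier_vec m" "M *\<^sub>v u = 0\<^sub>v m" for u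
  proof (rule eq_vecI)
    fix i assume "i < dim_vec (0\<^sub>v m :: real vec)"
    then have i: "i < m" by simp
    have "u $ i / c0 i = 0"
    proof (rule sigma_system_injective)
      show "u $ i / c0 i + (b (d + i))\<^sup>2 * (\<Sum>j<dt - d. u $ j / c0 j * poly (kern (y j)) (y i)) = 0"
        if "i < dt - d" for i
        using M_mult[OF u(1), of i] that u(2) by (simp add: m_def)
    qed (use i m_def in simp)
    then show "u $ i = 0\<^sub>v m $ i" using c0_pos[of i] i by (simp add: m_def)
  qed (use u in simp)
  have sol: "sigma_vec d dt lam b n \<in> carrier_vec m" "M *\<^sub>v sigma_vec d dt lam b n = w"
    unfolding sigma using mat_inverse_mult_vec[OF M w inj] by blast+
  show "dim_vec (sigma_vec d dt lam b n) = dt - d" using sol(1) by (simp add: m_def)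
  show "sg i / c0 i = (b (d + i))\<^sup>2 * poly R (y i)" if "i < dt - d"
  proof -
    have "(b (d + i))\<^sup>2 * poly (res n) (y i) = sg i / c0 i +
      (b (d + i))\<^sup>2 * (\<Sum>j<m. sg j / c0 j * poly (kern (y j)) (y i))"
      using M_mult[OF sol(1), of i] that unfolding sol(2) sg_def by (simp add: w_def m_def)
    then show ?thesis by (simp add: R_def poly_sum m_def right_diff_distrib)
  qed
qed

lemma S_eq: "S = (\<Sum>j<dt - d. \<bar>sg j\<bar>)"
  unfolding S_def l1_norm_def sigma_equations(1) sg_def ..

lemma ipt_split: "ipt p q = ip p q + (\<Sum>j<dt - d. (b (d + j))\<^sup>2 * poly p (y j) * poly q (y j))"
proof -
  have "ipt p q = ip p q + (\<Sum>i\<in>{d..<dt}. (b i)\<^sup>2 * poly p (lam i) * poly q (lam i))"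
    unfolding poly_ip_def lessThan_atLeast0 using d_le_dt by (simp add: sum.atLeastLessThan_concat)
  also have "(\<Sum>i\<in>{d..<dt}. (b i)\<^sup>2 * poly p (lam i) * poly q (lam i)) =
      (\<Sum>j<dt - d. (b (d + j))\<^sup>2 * poly p (y j) * poly q (y j))"
    by (rule sum.reindex_bij_witness[of _ "\<lambda>j. d + j" "\<lambda>i. i - d"]) (auto simp: y_def)
  finally show ?thesis .
qed

lemma definite_ext: "poly_ip_definite dt lam b n"
  unfolding poly_ip_definite_def
proof (intro ballI impI)
  fix p assume p: "p \<in> polys_below n" "ipt p p = 0"
  have "0 \<le> (\<Sum>j<dt - d. (b (d + j))\<^sup>2 * poly p (y j) * poly p (y j))"
    by (intro sum_nonneg) (simp add: mult.assoc)
  then have "ip p p = 0" using p(2) poly_ip_nonneg[of d lam b p] unfolding ipt_split by linarith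
  then show "p = 0" using definite p(1) by (auto simp: poly_ip_definite_def)
qed

text \<open>By the reproducing property the first \<open>d\<close> nodes contribute minus the sum of
  \<open>sg j / c0 j * poly q (y j)\<close>; the equations for \<open>sg\<close> say that the added
  nodes contribute the same sum with a plus sign.\<close>

lemma R_orth: "orth_below dt lam b n R"
  unfolding orth_below_def
proof
  fix q assume q: "q \<in> polys_below n"
  have "ip R q = - (\<Sum>j<dt - d. sg j / c0 j * poly q (y j))"
    using orth_belowD[OF res_cg_poly(8) q]
    by (simp add: R_def poly_ip_diff_left poly_ip_sum_left poly_ip_smult_left ip_kern[OF q])
  moreover have "(\<Sum>j<dt - d. (b (d + j))\<^sup>2 * poly R (y j) * poly q (y j)) =
      (\<Sum>j<dt - d. sg j / c0 j * poly q (y j))"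
    by (rule sum.cong) (simp_all add: sigma_equations(2))
  ultimately show "ipt R q = 0" by (simp add: ipt_split)
qed

text \<open>The coefficient of \<open>res k\<close> when the sum of kernels in \<open>R\<close> is
  expanded in residual polynomials.\<close>

definition tau :: "nat \<Rightarrow> real" where
  "tau k = (\<Sum>j<dt - d. sg j / c0 j * (poly (res k) (y j) / ip (res k) (res k)))"

text \<open>Every \<open>res k\<close> is 1 at 0, so \<open>1 - s\<close> is the value of
  \<open>R\<close> there.\<close>

definition s :: real where
  "s = (\<Sum>k<n. tau k)"

lemma R_eq: "R = res n - (\<Sum>k<n. Polynomial.smult (tau k) (res k))"
proof -
  have "(\<Sum>j<dt - d. Polynomial.smult (sg j / c0 j) (kern (y j))) =
      (\<Sum>k<n. Polynomial.smult (tau k) (res k))"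
  proof (rule poly_ext)
    fix x
    have "poly (\<Sum>j<dt - d. Polynomial.smult (sg j / c0 j) (kern (y j))) x =
      (\<Sum>j<dt - d. \<Sum>k<n. sg j / c0 j * (poly (res k) (y j) / ip (res k) (res k)) * poly (res k) x)"
      by (simp add: kern_def poly_sum sum_distrib_left mult.assoc)
    also have "\<dots> = (\<Sum>k<n. tau k * poly (res k) x)"
      by (subst sum.swap) (simp only: tau_def sum_distrib_right)
    finally show "poly (\<Sum>j<dt - d. Polynomial.smult (sg j / c0 j) (kern (y j))) x =
      poly (\<Sum>k<n. Polynomial.smult (tau k) (res k)) x" by (simp add: poly_sum)
  qed
  then show ?thesis by (simp add: R_def)
qed

text \<open>Left of \<open>L\<close> all \<open>res k\<close> are positive, and at 0 they are 1;
  hence each kernel divided by \<open>c0 j\<close> is a convex combination of the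
  \<open>res k\<close>, and mixing these with coefficients \<open>sg j\<close> cannot increase the
  sum of absolute values.\<close>

lemma sum_abs_tau: "(\<Sum>k<n. \<bar>tau k\<bar>) \<le> S"
proof -
  have "(\<Sum>k<n. \<bar>tau k\<bar>) \<le> (\<Sum>k<n. \<Sum>j<dt - d. \<bar>sg j\<bar> / c0 j * (poly (res k) (y j) / ip (res k) (res k)))"
  proof (rule sum_mono)
    fix k assume k: "k \<in> {..<n}"
    have "\<bar>tau k\<bar> \<le> (\<Sum>j<dt - d. \<bar>sg j / c0 j * (poly (res k) (y j) / ip (res k) (res k))\<bar>)"
      unfolding tau_def by (rule sum_abs)
    also have "\<dots> = (\<Sum>j<dt - d. \<bar>sg j\<bar> / c0 j * (poly (res k) (y j) / ip (res k) (res k)))"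
    proof (intro sum.cong refl)
      fix j assume "j \<in> {..<dt - d}"
      then show "\<bar>sg j / c0 j * (poly (res k) (y j) / ip (res k) (res k))\<bar> =
          \<bar>sg j\<bar> / c0 j * (poly (res k) (y j) / ip (res k) (res k))"
        using c0_pos[of j] ip_res_pos[of k] res_cg_poly(5)[OF _ y_less, of k j] k
        by (simp add: abs_mult)
    qed
    finally show "\<bar>tau k\<bar> \<le> (\<Sum>j<dt - d. \<bar>sg j\<bar> / c0 j * (poly (res k) (y j) / ip (res k) (res k)))" .
  qed
  also have "\<dots> = (\<Sum>j<dt - d. \<bar>sg j\<bar> / c0 j * c0 j)"
  proof (subst sum.swap, rule sum.cong)
    fix j
    have "c0 j = (\<Sum>k<n. poly (res k) (y j) / ip (res k) (res k))"
      by (simp add: c0_def kern_def poly_sum res_at_0)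
    then show "(\<Sum>k<n. \<bar>sg j\<bar> / c0 j * (poly (res k) (y j) / ip (res k) (res k))) = \<bar>sg j\<bar> / c0 j * c0 j"
      by (simp only: sum_distrib_left)
  qed simp
  also have "\<dots> = S" unfolding S_eq using c0_pos by (intro sum.cong) (auto simp: less_imp_neq[symmetric])
  finally show ?thesis .
qed

lemma R_coeff: "R \<in> polys_below (Suc n)" "Polynomial.coeff R n \<noteq> 0"
proof -
  define t where "t = (\<Sum>k<n. Polynomial.smult (tau k) (res k))"
  have t: "t \<in> polys_below n"
    unfolding t_def by (intro polys_below_sum polys_below_smult)
       (auto intro!: polys_below_mono[OF res_cg_poly(6)])
  have R: "R = res n - t" by (simp add: R_eq t_def)
  show "R \<in> polys_below (Suc n)" unfolding R
    using polys_below_mono[OF t] res_cg_poly(6) by (intro polys_below_diff) auto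
  show "Polynomial.coeff R n \<noteq> 0" unfolding R using t res_cg_poly(7)[of n] by (simp add: polys_below_def)
qed

section \<open>Consequences of \<open>S < 1\<close>: positivity, the extended iterate and the two
  estimates\<close>

context
  assumes S_less: "S < 1"
begin

text \<open>On the nonpositive axis each \<open>res k\<close> lies between 0 and
  \<open>res n\<close>, so \<open>R\<close> is at least \<open>1 - S\<close> times
  \<open>res n\<close>.\<close>

lemma R_pos:
  assumes "x \<le> 0"
  shows "0 < poly R x"
proof -
  have "(\<Sum>k<n. tau k * poly (res k) x) \<le> (\<Sum>k<n. \<bar>tau k\<bar> * poly (res n) x)"
  proof (rule sum_mono)
    fix k assume "k \<in> {..<n}"
    then have "0 < poly (res k) x" "poly (res k) x \<le> poly (res n) x"
      using res_cg_poly(5)[of k x] res_antimono[of k x] assms L_pos by auto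
    then show "tau k * poly (res k) x \<le> \<bar>tau k\<bar> * poly (res n) x"
      by (intro mult_mono) auto
  qed
  also have "\<dots> \<le> S * poly (res n) x"
    unfolding sum_distrib_right[symmetric] using sum_abs_tau res_cg_poly(5)[of n x] assms L_pos
    by (intro mult_right_mono) auto
  also have "\<dots> < poly (res n) x" using S_less res_cg_poly(5)[of n x] assms L_pos by simp
  finally show ?thesis by (simp add: R_eq poly_sum)
qed

text \<open>The added nodes may be negative; what counts is that \<open>R\<close>, the orthogonal
  polynomial of the extended form, has no root on the nonpositive axis.\<close>

lemma ipt_pCons_pos:
  assumes "p \<in> polys_below n" "p \<noteq> 0"
  shows "0 < ipt (pCons 0 p) p"
proof (rule poly_ip_pCons_pos[OF definite_ext R_orth R_coeff _ assms])
  show "0 < x" if "poly R x = 0" for x using R_pos[of x] that by force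
qed

text \<open>Dividing \<open>R\<close> by its value \<open>1 - s\<close> at 0, inserting 1 minus x
  times \<open>cg_poly k\<close> for each \<open>res k\<close> and splitting off the factor x leads
  to this polynomial.\<close>

definition ext_poly :: "real poly" where
  "ext_poly = Polynomial.smult (1 / (1 - s))
     (cg_poly n - (\<Sum>k<n. Polynomial.smult (tau k) (cg_poly k)))"

lemma s_le: "s \<le> S"
  unfolding s_def by (rule order_trans[OF sum_mono sum_abs_tau]) simp

lemma ext_poly_below: "ext_poly \<in> polys_below n"
  unfolding ext_poly_def
  by (intro polys_below_smult polys_below_diff polys_below_sum res_cg_poly(2))
     (auto intro!: polys_below_mono[OF res_cg_poly(2)])

lemma ext_poly_residual: "1 - pCons 0 ext_poly = Polynomial.smult (1 / (1 - s)) R"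
proof (rule poly_ext)
  fix x
  have "poly (res k) x = 1 - x * poly (cg_poly k) x" if "k \<le> n" for k
    using res_cg_poly(1)[OF that] by simp
  then have "poly R x = 1 - x * poly (cg_poly n) x - (\<Sum>k<n. tau k * (1 - x * poly (cg_poly k) x))"
    by (simp add: R_eq poly_sum)
  also have "\<dots> = 1 - s - x * (poly (cg_poly n) x - (\<Sum>k<n. tau k * poly (cg_poly k) x))"
    by (simp add: algebra_simps sum_subtractf sum_distrib_left s_def)
  finally show "poly (1 - pCons 0 ext_poly) x = poly (Polynomial.smult (1 / (1 - s)) R) x"
    using s_le S_less by (simp add: ext_poly_def poly_sum field_simps)
qed

lemma ext_poly_orth: "q \<in> polys_below n \<Longrightarrow> ipt (1 - pCons 0 ext_poly) q = 0"
  unfolding ext_poly_residual by (simp add: poly_ip_smult_left orth_belowD[OF R_orth])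

text \<open>The difference is \<open>1 / (1 - s)\<close> times the sum of \<open>tau k\<close> times
  \<open>cg_poly n - cg_poly k\<close>. In the orthogonal basis \<open>res j\<close> the
  coefficients of each \<open>cg_poly n - cg_poly k\<close> lie between 0 and those of
  \<open>cg_poly n\<close>, so norms can be compared coefficient by coefficient.\<close>

lemma ext_poly_diff_norm:
  "poly_norm d lam b (ext_poly - cg_poly n) \<le> S / (1 - S) * poly_norm d lam b (cg_poly n)"
proof -
  have "\<forall>k. \<exists>c. k < n \<longrightarrow> cg_poly n - cg_poly k = (\<Sum>j<n. Polynomial.smult (c j) (res j)) \<and>
      (\<forall>j<n. 0 \<le> c j \<and> c j \<le> cg_coeff j)"
  proof
    fix k
    show "\<exists>c. k < n \<longrightarrow> cg_poly n - cg_poly k = (\<Sum>j<n. Polynomial.smult (c j) (res j)) \<and>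
      (\<forall>j<n. 0 \<le> c j \<and> c j \<le> cg_coeff j)"
    proof (cases "k < n")
      case True
      then obtain c where "cg_poly n - cg_poly k = (\<Sum>j<n. Polynomial.smult (c j) (res j))"
        "\<And>j. j < n \<Longrightarrow> 0 \<le> c j \<and> c j \<le> cg_coeff j"
        using cg_poly_diff_expansion[of k] by (metis less_imp_le)
      then show ?thesis by auto
    qed simp
  qed
  then obtain c where c: "\<And>k. k < n \<Longrightarrow> cg_poly n - cg_poly k = (\<Sum>j<n. Polynomial.smult (c k j) (res j))"
    "\<And>k j. k < n \<Longrightarrow> j < n \<Longrightarrow> 0 \<le> c k j \<and> c k j \<le> cg_coeff j"
    by metis
  \<comment> \<open>Coefficient of \<open>res j\<close> in
    \<open>ext_poly - cg_poly n\<close>.\<close>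
  define g where "g = (\<lambda>j. (\<Sum>k<n. tau k * c k j) / (1 - s))"
  have s1: "0 < 1 - s" and S1: "0 < 1 - S" "1 - S \<le> 1 - s" using s_le S_less by auto
  have S0: "0 \<le> S" by (rule order_trans[OF sum_nonneg sum_abs_tau]) simp
  have "ext_poly - cg_poly n = Polynomial.smult (1 / (1 - s))
      (\<Sum>k<n. Polynomial.smult (tau k) (cg_poly n - cg_poly k))"
  proof (rule poly_ext)
    fix x
    have "(\<Sum>k<n. tau k * (poly (cg_poly n) x - poly (cg_poly k) x)) =
        s * poly (cg_poly n) x - (\<Sum>k<n. tau k * poly (cg_poly k) x)"
      by (simp add: algebra_simps sum_subtractf sum_distrib_left s_def)
    then show "poly (ext_poly - cg_poly n) x = poly (Polynomial.smult (1 / (1 - s))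
      (\<Sum>k<n. Polynomial.smult (tau k) (cg_poly n - cg_poly k))) x"
      using s1 by (simp add: ext_poly_def poly_sum field_simps)
  qed
  also have "\<dots> = (\<Sum>j<n. Polynomial.smult (g j) (res j))"
  proof (rule poly_ext)
    fix x
    have "poly (Polynomial.smult (1 / (1 - s))
        (\<Sum>k<n. Polynomial.smult (tau k) (cg_poly n - cg_poly k))) x =
      1 / (1 - s) * (\<Sum>k<n. tau k * poly (\<Sum>j<n. Polynomial.smult (c k j) (res j)) x)"
    proof -
      have "(\<Sum>k<n. Polynomial.smult (tau k) (cg_poly n - cg_poly k)) =
          (\<Sum>k<n. Polynomial.smult (tau k) (\<Sum>j<n. Polynomial.smult (c k j) (res j)))"
        by (rule sum.cong) (simp_all only: c(1) lessThan_iff)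
      then show ?thesis by (simp only: poly_smult poly_sum)
    qed
    also have "\<dots> = 1 / (1 - s) * (\<Sum>k<n. \<Sum>j<n. tau k * c k j * poly (res j) x)"
      by (simp add: poly_sum sum_distrib_left mult.assoc)
    also have "\<dots> = 1 / (1 - s) * (\<Sum>j<n. (\<Sum>k<n. tau k * c k j) * poly (res j) x)"
      by (subst sum.swap) (simp only: sum_distrib_right)
    finally show "poly (Polynomial.smult (1 / (1 - s))
        (\<Sum>k<n. Polynomial.smult (tau k) (cg_poly n - cg_poly k))) x =
      poly (\<Sum>j<n. Polynomial.smult (g j) (res j)) x"
      unfolding poly_sum poly_smult sum_distrib_left[of "1 / (1 - s)"] by (simp add: g_def)
  qed
  finally have eq: "ext_poly - cg_poly n = (\<Sum>j<n. Polynomial.smult (g j) (res j))" .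
  have g_le: "\<bar>g j\<bar> \<le> \<bar>S / (1 - S) * cg_coeff j\<bar>" if "j < n" for j
  proof -
    \<comment> \<open>Read off from the two bounds for \<open>k = 0\<close>, an index that exists
      because \<open>j < n\<close>.\<close>
    have cg: "0 \<le> cg_coeff j" using c(2)[of 0 j] that by force
    have "\<bar>\<Sum>k<n. tau k * c k j\<bar> \<le> (\<Sum>k<n. \<bar>tau k\<bar> * cg_coeff j)"
      using c(2) that by (intro order_trans[OF sum_abs] sum_mono) (auto simp: abs_mult intro!: mult_left_mono)
    also have "\<dots> \<le> S * cg_coeff j"
      unfolding sum_distrib_right[symmetric] using sum_abs_tau cg by (rule mult_right_mono)
    finally have "\<bar>g j\<bar> \<le> S * cg_coeff j / (1 - s)" using s1 by (simp add: g_def divide_right_mono)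
    also have "\<dots> \<le> S * cg_coeff j / (1 - S)" using S0 S1 cg by (intro frac_le) auto
    finally show ?thesis using S0 S1 cg by simp
  qed
  have "ip (ext_poly - cg_poly n) (ext_poly - cg_poly n) = (\<Sum>j<n. (g j)\<^sup>2 * ip (res j) (res j))"
    unfolding eq by (rule ip_sum_res_sq)
  also have "\<dots> \<le> (\<Sum>j<n. (S / (1 - S))\<^sup>2 * ((cg_coeff j)\<^sup>2 * ip (res j) (res j)))"
  proof (rule sum_mono)
    fix j assume "j \<in> {..<n}"
    then have "(g j)\<^sup>2 \<le> (S / (1 - S) * cg_coeff j)\<^sup>2"
      using g_le[of j] by (simp only: abs_le_square_iff lessThan_iff)
    then have "(g j)\<^sup>2 * ip (res j) (res j) \<le> (S / (1 - S) * cg_coeff j)\<^sup>2 * ip (res j) (res j)"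
      using poly_ip_nonneg by (rule mult_right_mono)
    then show "(g j)\<^sup>2 * ip (res j) (res j) \<le> (S / (1 - S))\<^sup>2 * ((cg_coeff j)\<^sup>2 * ip (res j) (res j))"
      by (simp only: power_mult_distrib mult.assoc)
  qed
  also have "\<dots> = (S / (1 - S))\<^sup>2 * ip (cg_poly n) (cg_poly n)"
    unfolding cg_poly_n_expansion ip_sum_res_sq sum_distrib_left ..
  finally have "poly_norm d lam b (ext_poly - cg_poly n) \<le> sqrt ((S / (1 - S))\<^sup>2 * ip (cg_poly n) (cg_poly n))"
    unfolding poly_norm_def by (rule real_sqrt_le_mono)
  also have "\<dots> = S / (1 - S) * poly_norm d lam b (cg_poly n)"
    using S0 S1 by (simp add: poly_norm_def real_sqrt_mult)
  finally show ?thesis .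
qed

text \<open>Bounding the numerator by (1 + T) P would be too weak. Positive and negative
  \<open>tau k\<close> are treated separately, since the negative ones also enlarge the denominator
  \<open>1 - s\<close>.\<close>

lemma abs_ext_poly_le:
  assumes "x < L"
  shows "\<bar>poly ext_poly x\<bar> \<le> 1 / (1 - S) * ((\<Sum>k<n. (1 - x / L) ^ k) / L)"
proof -
  define P where "P = poly (cg_poly n) x"
  define T where "T = (\<Sum>k<n. \<bar>tau k\<bar>)"
  define u where "u = (\<Sum>k<n. tau k * poly (cg_poly k) x)"
  have p: "0 \<le> poly (cg_poly k) x" "poly (cg_poly k) x \<le> P" if "k < n" for k
    using res_cg_poly(3)[of k x] cg_poly_mono[of k x] that assms by (auto simp: P_def)
  have P: "0 \<le> P" "P \<le> (\<Sum>k<n. (1 - x / L) ^ k) / L"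
    using res_cg_poly(3,4)[of n x] assms by (auto simp: P_def)
  have s1: "0 < 1 - s" and S1: "0 < 1 - S" and T: "T \<le> S" "0 \<le> T" "\<bar>s\<bar> \<le> T"
    using s_le S_less sum_abs_tau by (auto simp: T_def s_def intro: sum_nonneg sum_abs)
  have u1: "u \<le> (T + s) / 2 * P"
  proof -
    have "u \<le> (\<Sum>k<n. (\<bar>tau k\<bar> + tau k) / 2 * P)"
      unfolding u_def
    proof (rule sum_mono)
      fix k assume "k \<in> {..<n}"
      then show "tau k * poly (cg_poly k) x \<le> (\<bar>tau k\<bar> + tau k) / 2 * P"
        using p[of k] by (cases "0 \<le> tau k") (auto intro: mult_left_mono simp: mult_nonpos_nonneg)
    qed
    then show ?thesis by (simp add: T_def s_def sum.distrib sum_distrib_right[symmetric] sum_divide_distrib[symmetric])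
  qed
  have u2: "- u \<le> (T - s) / 2 * P"
  proof -
    have "- u \<le> (\<Sum>k<n. (\<bar>tau k\<bar> - tau k) / 2 * P)"
      unfolding u_def sum_negf[symmetric]
    proof (rule sum_mono)
      fix k assume "k \<in> {..<n}"
      then show "- (tau k * poly (cg_poly k) x) \<le> (\<bar>tau k\<bar> - tau k) / 2 * P"
        using p[of k] by (cases "0 \<le> tau k") (auto intro: mult_left_mono_neg simp: mult_left_mono_neg)
    qed
    also have "\<dots> = (T - s) / 2 * P"
      by (simp only: T_def s_def sum_subtractf sum_distrib_right[symmetric] sum_divide_distrib[symmetric])
    finally show ?thesis .
  qed
  \<comment> \<open>Here \<open>a\<close> and \<open>c\<close> are the total negative and positive
    parts of the \<open>tau k\<close>; hence \<open>u\<close> lies between \<open>- a * P\<close>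
    and \<open>c * P\<close>.\<close>
  define a where "a = (T - s) / 2"
  define c where "c = (T + s) / 2"
  have ac: "0 \<le> a" "0 \<le> c" "T = a + c" "s = c - a" using T by (auto simp: a_def c_def field_simps)
  have "\<bar>P - u\<bar> \<le> (1 + a) * P"
  proof (rule abs_leI)
    show "P - u \<le> (1 + a) * P" using u2 by (simp add: distrib_right flip: a_def)
    \<comment> \<open>This is where \<open>S < 1\<close> keeps \<open>u\<close> from exceeding
      \<open>P\<close>.\<close>
    have "c \<le> 1" using ac T S_less by linarith
    then have "c * P \<le> 1 * P" using P(1) by (rule mult_right_mono)
    then have "- (P - u) \<le> 0" using u1 by (simp add: c_def)
    also have "0 \<le> (1 + a) * P" using ac P by simp
    finally show "- (P - u) \<le> (1 + a) * P" .
  qed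
  \<comment> \<open>The comparison of (1 + a) / (1 - s) with 1 / (1 - S) is multiplied out, with
    \<open>T\<close> in place of \<open>S\<close>; the two sides then differ by
    \<open>a + a * a + a * c\<close>.\<close>
  then have "\<bar>P - u\<bar> * (1 - S) \<le> (1 + a) * P * (1 - T)"
    using S1 T ac P by (intro mult_mono) auto
  also have "\<dots> = ((1 + a) * (1 - T)) * P" by simp
  also have "(1 + a) * (1 - T) = (1 - s) - (a + a * a + a * c)"
    using ac by (simp add: algebra_simps)
  also have "((1 - s) - (a + a * a + a * c)) * P \<le> (1 - s) * P"
  proof (rule mult_right_mono)
    have "0 \<le> a + a * a + a * c" using ac by simp
    then show "(1 - s) - (a + a * a + a * c) \<le> 1 - s" by linarith
  qed (rule P(1))
  finally have "\<bar>P - u\<bar> / (1 - s) \<le> P / (1 - S)"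
    using s1 S1 by (simp add: field_simps)
  also have "\<dots> \<le> ((\<Sum>k<n. (1 - x / L) ^ k) / L) / (1 - S)"
    using P(2) S1 by (intro divide_right_mono) auto
  also have "\<dots> = 1 / (1 - S) * ((\<Sum>k<n. (1 - x / L) ^ k) / L)" by simp
  also have "\<bar>P - u\<bar> / (1 - s) = \<bar>poly ext_poly x\<bar>"
    using s1 by (simp add: ext_poly_def P_def u_def poly_sum)
  finally show ?thesis .
qed

end

end

section \<open>Krylov spaces of diagonal matrices\<close>

text \<open>The vector p(A) b for the diagonal matrix A with entries \<open>lam\<close>.\<close>

definition poly_vec :: "nat \<Rightarrow> (nat \<Rightarrow> real) \<Rightarrow> (nat \<Rightarrow> real) \<Rightarrow> real poly \<Rightarrow> real vec" where
  "poly_vec d lam b p = Matrix.vec d (\<lambda>i. b i * poly p (lam i))"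

lemma poly_vec_carrier [simp]: "poly_vec d lam b p \<in> carrier_vec d"
  by (simp add: poly_vec_def)

lemma dim_poly_vec [simp]: "dim_vec (poly_vec d lam b p) = d"
  by (simp add: poly_vec_def)

lemma index_poly_vec [simp]: "i < d \<Longrightarrow> poly_vec d lam b p $ i = b i * poly p (lam i)"
  by (simp add: poly_vec_def)

lemma poly_vec_0: "poly_vec d lam b 0 = 0\<^sub>v d"
  and poly_vec_1: "poly_vec d lam b 1 = Matrix.vec d b"
  and poly_vec_add: "poly_vec d lam b (p + q) = poly_vec d lam b p + poly_vec d lam b q"
  and poly_vec_diff: "poly_vec d lam b (p - q) = poly_vec d lam b p - poly_vec d lam b q"
  and poly_vec_smult: "poly_vec d lam b (Polynomial.smult c p) = c \<cdot>\<^sub>v poly_vec d lam b p"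
  by (auto simp: algebra_simps)

lemma mat_diag_mult_poly_vec: "mat_diag d lam *\<^sub>v poly_vec d lam b p = poly_vec d lam b (pCons 0 p)"
  by (subst mat_diag_mult_vec) (auto simp: mult_ac)

lemma poly_vec_scalar_prod: "poly_vec d lam b p \<bullet> poly_vec d lam b q = poly_ip d lam b p q"
  by (simp add: scalar_prod_def poly_ip_def atLeast0LessThan power2_eq_square mult_ac)

lemma poly_vec_eq_0_iff: "poly_vec d lam b p = 0\<^sub>v d \<longleftrightarrow> poly_ip d lam b p p = 0"
proof
  assume "poly_ip d lam b p p = 0"
  then have "(\<Sum>i<d. (b i * poly p (lam i))\<^sup>2) = 0"
    by (simp add: poly_ip_def power2_eq_square mult_ac)
  then have "\<forall>i<d. b i * poly p (lam i) = 0" by (subst (asm) sum_nonneg_eq_0_iff) auto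
  then show "poly_vec d lam b p = 0\<^sub>v d" by auto
qed (simp flip: poly_vec_scalar_prod)

definition krylov_vec :: "nat \<Rightarrow> (nat \<Rightarrow> real) \<Rightarrow> (nat \<Rightarrow> real) \<Rightarrow> nat \<Rightarrow> real vec" where
  "krylov_vec d lam b k = poly_vec d lam b (Polynomial.monom 1 k)"

lemma mat_diag_power_mult_vec:
  "(mat_diag d lam ^\<^sub>m k) *\<^sub>v Matrix.vec d b = krylov_vec d lam b k"
  unfolding mat_diag_power krylov_vec_def
  by (subst mat_diag_mult_vec) (auto simp: poly_monom mult_ac)

context
  fixes d :: nat and lam b :: "nat \<Rightarrow> real"
begin

interpretation V: vec_space "TYPE(real)" d .

lemma krylov_eq_span:
  "krylov (mat_diag d lam) (Matrix.vec d b) N = V.span (krylov_vec d lam b ` {..<N})"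
  unfolding krylov_def mat_diag_power_mult_vec by simp

lemma krylov_vec_carrier: "krylov_vec d lam b ` {..<N} \<subseteq> carrier_vec d"
  by (auto simp: krylov_vec_def)

lemma krylov_mat_diag:
  "krylov (mat_diag d lam) (Matrix.vec d b) N = poly_vec d lam b ` polys_below N"
proof
  have "LinearCombinations.submodule class_ring (poly_vec d lam b ` polys_below N) V.V"
    unfolding LinearCombinations.submodule_def
  proof (intro conjI allI impI)
    show "\<zero>\<^bsub>V.V\<^esub> \<in> poly_vec d lam b ` polys_below N"
      by (auto intro!: image_eqI[of _ _ 0] simp: poly_vec_0)
    show "v \<oplus>\<^bsub>V.V\<^esub> w \<in> poly_vec d lam b ` polys_below N"
      if "v \<in> poly_vec d lam b ` polys_below N" "w \<in> poly_vec d lam b ` polys_below N" for v w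
      using that by (auto simp flip: poly_vec_add intro!: imageI polys_below_add)
    show "r \<odot>\<^bsub>V.V\<^esub> v \<in> poly_vec d lam b ` polys_below N"
      if "r \<in> carrier class_ring" "v \<in> poly_vec d lam b ` polys_below N" for r v
      using that by (auto simp flip: poly_vec_smult intro!: imageI polys_below_smult)
  qed (auto intro: V.module_axioms)
  moreover have "krylov_vec d lam b ` {..<N} \<subseteq> poly_vec d lam b ` polys_below N"
    by (auto simp: krylov_vec_def polys_below_def intro!: imageI)
  ultimately show "krylov (mat_diag d lam) (Matrix.vec d b) N \<subseteq> poly_vec d lam b ` polys_below N"
    unfolding krylov_eq_span by (intro V.span_is_subset)
  have "poly_vec d lam b p \<in> V.span (krylov_vec d lam b ` {..<N})" if "p \<in> polys_below N" for p
    using that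
  proof (induction N arbitrary: p)
    case 0
    then show ?case using V.span_is_submodule[of "{}"] by (simp add: poly_vec_0 LinearCombinations.submodule_def)
  next
    case (Suc N)
    define c where "c = Polynomial.coeff p N"
    define q where "q = p - Polynomial.smult c (Polynomial.monom 1 N)"
    have "(Polynomial.monom 1 N :: real poly) \<in> polys_below (Suc N)" by (simp add: polys_below_def)
    from polys_below_decompose[OF Suc.prems this] have "q \<in> polys_below N"
      by (simp add: q_def c_def)
    then have "poly_vec d lam b q \<in> V.span (krylov_vec d lam b ` {..<N})" by (rule Suc.IH)
    also have "V.span (krylov_vec d lam b ` {..<N}) \<subseteq> V.span (krylov_vec d lam b ` {..<Suc N})"
      by (intro V.span_is_monotone image_mono) auto
    finally have q: "poly_vec d lam b q \<in> V.span (krylov_vec d lam b ` {..<Suc N})" .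
    have "krylov_vec d lam b N \<in> V.span (krylov_vec d lam b ` {..<Suc N})"
      using V.in_own_span[OF krylov_vec_carrier] by blast
    then have "c \<cdot>\<^sub>v krylov_vec d lam b N \<in> V.span (krylov_vec d lam b ` {..<Suc N})"
      using krylov_vec_carrier by (intro V.smult_in_span) auto
    from V.span_add1[OF krylov_vec_carrier q this]
    have "poly_vec d lam b q + c \<cdot>\<^sub>v krylov_vec d lam b N \<in> V.span (krylov_vec d lam b ` {..<Suc N})"
      by simp
    also have "poly_vec d lam b q + c \<cdot>\<^sub>v krylov_vec d lam b N = poly_vec d lam b p"
      unfolding krylov_vec_def poly_vec_smult[symmetric] poly_vec_add[symmetric] by (simp add: q_def)
    finally show ?case .
  qed
  then show "poly_vec d lam b ` polys_below N \<subseteq> krylov (mat_diag d lam) (Matrix.vec d b) N"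
    unfolding krylov_eq_span by blast
qed

text \<open>\<open>lincomb\<close> attaches coefficients to vectors, not to exponents; injectivity
  ensures that no two generators are merged.\<close>

lemma lincomb_krylov_vec:
  assumes "inj_on (krylov_vec d lam b) {..<N}"
  shows "V.lincomb a (krylov_vec d lam b ` {..<N}) =
    poly_vec d lam b (\<Sum>k<N. Polynomial.monom (a (krylov_vec d lam b k)) k)"
proof (rule eq_vecI)
  fix i assume "i < dim_vec (poly_vec d lam b (\<Sum>k<N. Polynomial.monom (a (krylov_vec d lam b k)) k))"
  then have i: "i < d" by simp
  have "V.lincomb a (krylov_vec d lam b ` {..<N}) $ i =
      (\<Sum>x\<in>krylov_vec d lam b ` {..<N}. a x * x $ i)"
    using i krylov_vec_carrier[of N] by (intro V.lincomb_index) simp_all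
  also have "\<dots> = (\<Sum>k<N. a (krylov_vec d lam b k) * krylov_vec d lam b k $ i)"
    by (simp add: sum.reindex[OF assms])
  also have "\<dots> = b i * poly (\<Sum>k<N. Polynomial.monom (a (krylov_vec d lam b k)) k) (lam i)"
    using i by (simp add: krylov_vec_def poly_monom poly_sum sum_distrib_left mult_ac)
  finally show "V.lincomb a (krylov_vec d lam b ` {..<N}) $ i =
      poly_vec d lam b (\<Sum>k<N. Polynomial.monom (a (krylov_vec d lam b k)) k) $ i"
    using i by simp
next
  show "dim_vec (V.lincomb a (krylov_vec d lam b ` {..<N})) =
      dim_vec (poly_vec d lam b (\<Sum>k<N. Polynomial.monom (a (krylov_vec d lam b k)) k))"
    using V.lincomb_dim[of "krylov_vec d lam b ` {..<N}" a] krylov_vec_carrier[of N] by simp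
qed

lemma coeff_sum_monom: "Polynomial.coeff (\<Sum>k<N. Polynomial.monom (f k) k) j = (if j < N then f j else 0)"
proof -
  have "Polynomial.coeff (\<Sum>k<N. Polynomial.monom (f k) k) j = (\<Sum>k<N. if k = j then f k else 0)"
    by (simp add: Polynomial.coeff_sum)
  then show ?thesis by simp
qed

text \<open>Injectivity is a separate conjunct because independence of a set ignores repeated
  generators. Together the two say that no nonzero polynomial in \<open>polys_below N\<close>
  annihilates the starting vector.\<close>

lemma lin_indpt_krylov_iff:
  "inj_on (krylov_vec d lam b) {..<N} \<and> V.lin_indpt (krylov_vec d lam b ` {..<N}) \<longleftrightarrow>
    poly_ip_definite d lam b N"
proof
  let ?G = "krylov_vec d lam b ` {..<N}"
  assume L: "inj_on (krylov_vec d lam b) {..<N} \<and> V.lin_indpt ?G"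
  show "poly_ip_definite d lam b N"
    unfolding poly_ip_definite_def
  proof (intro ballI impI)
    fix p assume p: "p \<in> polys_below N" "poly_ip d lam b p p = 0"
    \<comment> \<open>Carries the coefficients of \<open>p\<close> from exponents over to
      generators.\<close>
    define a where "a = (\<lambda>x. Polynomial.coeff p (the_inv_into {..<N} (krylov_vec d lam b) x))"
    have a: "a (krylov_vec d lam b k) = Polynomial.coeff p k" if "k < N" for k
      using L that by (simp add: a_def the_inv_into_f_f)
    have "(\<Sum>k<N. Polynomial.monom (a (krylov_vec d lam b k)) k) = p"
      using p(1) by (intro poly_eqI) (auto simp: coeff_sum_monom a polys_below_def)
    then have "V.lincomb a ?G = 0\<^sub>v d"
      using L p(2) by (simp add: lincomb_krylov_vec poly_vec_eq_0_iff)
    then have "a \<in> ?G \<rightarrow> {0}" using L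
      by (intro V.not_lindepD[of ?G ?G a]) simp_all
    then have "a (krylov_vec d lam b k) = 0" if "k < N" for k
      using that by (auto simp: Pi_iff)
    then have "Polynomial.coeff p k = 0" for k
      using a[of k] p(1) by (cases "k < N") (auto simp: polys_below_def)
    then show "p = 0" by (intro poly_eqI) simp
  qed
next
  let ?G = "krylov_vec d lam b ` {..<N}"
  assume def: "poly_ip_definite d lam b N"
  have inj: "inj_on (krylov_vec d lam b) {..<N}"
  proof (rule inj_onI)
    fix j k assume jk: "j \<in> {..<N}" "k \<in> {..<N}" "krylov_vec d lam b j = krylov_vec d lam b k"
    define p :: "real poly" where "p = Polynomial.monom 1 j - Polynomial.monom 1 k"
    have "p \<in> polys_below N" using jk(1,2) by (auto simp: p_def polys_below_def)
    moreover have "poly_vec d lam b p = 0\<^sub>v d"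
      using jk(3) unfolding p_def krylov_vec_def poly_vec_diff by simp
    ultimately have "p = 0" using def by (auto simp: poly_vec_eq_0_iff poly_ip_definite_def)
    then have "Polynomial.coeff (Polynomial.monom (1::real) j) j = Polynomial.coeff (Polynomial.monom 1 k) j"
      by (simp add: p_def)
    then show "j = k" by (simp split: if_splits)
  qed
  have "V.lin_indpt ?G"
  proof (rule V.finite_lin_indpt2)
    fix a assume "V.lincomb a ?G = 0\<^sub>v d"
    then have "poly_ip d lam b (\<Sum>k<N. Polynomial.monom (a (krylov_vec d lam b k)) k)
        (\<Sum>k<N. Polynomial.monom (a (krylov_vec d lam b k)) k) = 0"
      by (simp add: lincomb_krylov_vec[OF inj] poly_vec_eq_0_iff)
    moreover have "(\<Sum>k<N. Polynomial.monom (a (krylov_vec d lam b k)) k) \<in> polys_below N"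
      by (simp add: polys_below_def coeff_sum_monom)
    ultimately have "(\<Sum>k<N. Polynomial.monom (a (krylov_vec d lam b k)) k) = 0"
      using def by (auto simp: poly_ip_definite_def)
    then have coeff: "Polynomial.coeff (\<Sum>k<N. Polynomial.monom (a (krylov_vec d lam b k)) k) k = 0" for k
      by simp
    have "a (krylov_vec d lam b k) = 0" if "k < N" for k
      using coeff[of k] that by (simp add: coeff_sum_monom)
    then show "\<forall>v\<in>?G. a v = 0" by auto
  qed (use krylov_vec_carrier in auto)
  then show "inj_on (krylov_vec d lam b) {..<N} \<and> V.lin_indpt ?G" using inj by blast
qed

text \<open>The dimension of a span is the size of a maximal independent subset of its generators,
  which is all of them if they are independent.\<close>

lemma krylov_dim_maximal:
  obtains U where "U \<subseteq> krylov_vec d lam b ` {..<N}" "V.lin_indpt U"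
    "krylov_dim (mat_diag d lam) (Matrix.vec d b) N = card U"
    "V.lin_indpt (krylov_vec d lam b ` {..<N}) \<Longrightarrow> U = krylov_vec d lam b ` {..<N}"
proof -
  let ?G = "krylov_vec d lam b ` {..<N}"
  let ?P = "\<lambda>T. T \<subseteq> ?G \<and> V.lin_indpt T"
  have "\<exists>U. finite U \<and> maximal U ?P"
  proof (rule maximal_exists)
    show "?P T \<Longrightarrow> finite T \<and> card T \<le> card ?G" for T
      by (auto intro: card_mono finite_subset)
    show "?P {}" by (use V.finite_lin_indpt2[of "{}"] in simp)
  qed
  then obtain U where U: "maximal U ?P" by blast
  have "krylov_dim (mat_diag d lam) (Matrix.vec d b) N = card U"
    unfolding krylov_dim_def krylov_eq_span using V.dim_span[OF krylov_vec_carrier _ U] by simp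
  moreover have "V.lin_indpt ?G \<Longrightarrow> U = ?G" using U unfolding maximal_def by blast
  moreover have "U \<subseteq> ?G" "V.lin_indpt U" using U unfolding maximal_def by blast+
  ultimately show thesis using that by metis
qed

text \<open>Always \<open>card U \<le> card ?G\<close> and \<open>card ?G \<le> N\<close>; equality
  throughout means that the generators are distinct and independent.\<close>

lemma krylov_dim_eq_iff:
  "krylov_dim (mat_diag d lam) (Matrix.vec d b) N = N \<longleftrightarrow> poly_ip_definite d lam b N"
proof -
  let ?G = "krylov_vec d lam b ` {..<N}"
  obtain U where U: "U \<subseteq> ?G" "V.lin_indpt U"
    "krylov_dim (mat_diag d lam) (Matrix.vec d b) N = card U" "V.lin_indpt ?G \<Longrightarrow> U = ?G"
    using krylov_dim_maximal[of N] by metis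
  have "card U = N \<longleftrightarrow> inj_on (krylov_vec d lam b) {..<N} \<and> V.lin_indpt ?G"
  proof
    assume "card U = N"
    moreover have "card U \<le> card ?G" "card ?G \<le> N"
      using U(1) by (auto intro: card_mono simp: card_image_le[of "{..<N}", simplified])
    ultimately have "card ?G = N" "card U = card ?G" by auto
    moreover from this(2) have "U = ?G" using U(1) by (intro card_subset_eq) auto
    ultimately have "card ?G = N" "U = ?G" by auto
    then show "inj_on (krylov_vec d lam b) {..<N} \<and> V.lin_indpt ?G"
      using U(2) by (auto intro: eq_card_imp_inj_on)
  qed (use U(4) card_image in force)
  then show ?thesis using U(3) lin_indpt_krylov_iff by simp
qed

lemma krylov_dim_le: "krylov_dim (mat_diag d lam) (Matrix.vec d b) N \<le> d"
proof -
  obtain U where U: "U \<subseteq> krylov_vec d lam b ` {..<N}" "V.lin_indpt U"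
    "krylov_dim (mat_diag d lam) (Matrix.vec d b) N = card U"
    using krylov_dim_maximal[of N] by metis
  then show ?thesis using V.li_le_dim(2)[OF V.fin_dim _ U(2)] krylov_vec_carrier[of N] V.dim_is_n by auto
qed

end

section \<open>Grade and CG iterates of diagonal problems in terms of polynomials\<close>

lemma le_krylov_grade_iff:
  "N \<le> krylov_grade (mat_diag d lam) (Matrix.vec d b) \<longleftrightarrow> poly_ip_definite d lam b N"
proof
  let ?D = "krylov_dim (mat_diag d lam) (Matrix.vec d b)"
  \<comment> \<open>\<open>GREATEST\<close> denotes a true maximum: 0 satisfies the condition, and
    the dimension is bounded by \<open>d\<close>. Definiteness passes to smaller indices, so it
    characterizes every \<open>N\<close> up to the grade.\<close>
  have bound: "\<And>m. ?D m = m \<Longrightarrow> m \<le> d" using krylov_dim_le by metis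
  have "poly_ip_definite d lam b 0" by (simp add: poly_ip_definite_def)
  then have "?D 0 = 0" by (simp only: krylov_dim_eq_iff)
  from GreatestI_nat[of "\<lambda>m. ?D m = m", OF this bound]
  have "?D (krylov_grade (mat_diag d lam) (Matrix.vec d b)) = krylov_grade (mat_diag d lam) (Matrix.vec d b)"
    unfolding krylov_grade_def .
  then show "N \<le> krylov_grade (mat_diag d lam) (Matrix.vec d b) \<Longrightarrow> poly_ip_definite d lam b N"
    unfolding krylov_dim_eq_iff by (rule poly_ip_definite_mono)
  show "poly_ip_definite d lam b N \<Longrightarrow> N \<le> krylov_grade (mat_diag d lam) (Matrix.vec d b)"
    unfolding krylov_grade_def krylov_dim_eq_iff[symmetric]
    using Greatest_le_nat[of "\<lambda>m. ?D m = m" N d] bound by blast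
qed

lemma cg_well_defined_mat_diagI:
  assumes "poly_ip_definite d lam b N"
    and pos: "\<And>p. p \<in> polys_below N \<Longrightarrow> p \<noteq> 0 \<Longrightarrow> 0 < poly_ip d lam b (pCons 0 p) p"
  shows "cg_well_defined (mat_diag d lam) (Matrix.vec d b) N"
  unfolding cg_well_defined_def le_krylov_grade_iff krylov_mat_diag
proof (intro conjI assms(1) ballI impI)
  fix v assume "v \<in> poly_vec d lam b ` polys_below N" "v \<noteq> 0\<^sub>v (dim_vec (Matrix.vec d b))"
  then obtain p where p: "v = poly_vec d lam b p" "p \<in> polys_below N" and "v \<noteq> 0\<^sub>v d" by auto
  then have "p \<noteq> 0" by (auto simp: poly_vec_0)
  show "0 < v \<bullet> (mat_diag d lam *\<^sub>v v)"
    unfolding p(1) mat_diag_mult_poly_vec poly_vec_scalar_prod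
    using pos[OF p(2) \<open>p \<noteq> 0\<close>] by (simp only: poly_ip_commute)
qed

text \<open>Orthogonality of the residual (the Galerkin condition) removes the linear term: moving
  from \<open>P\<close> to \<open>P + q\<close> raises the objective by exactly half of <x q, q>,
  which is positive for \<open>q \<noteq> 0\<close>.\<close>

lemma cg_iterate_mat_diag:
  assumes pos: "\<And>p. p \<in> polys_below N \<Longrightarrow> p \<noteq> 0 \<Longrightarrow> 0 < poly_ip d lam b (pCons 0 p) p"
    and P: "P \<in> polys_below N"
    and orth: "\<And>q. q \<in> polys_below N \<Longrightarrow> poly_ip d lam b (1 - pCons 0 P) q = 0"
  shows "cg_iterate (mat_diag d lam) (Matrix.vec d b) N = poly_vec d lam b P"
  unfolding cg_iterate_def
proof (rule the_minimizer_eqI)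
  define f where "f = (\<lambda>v. 1/2 * (v \<bullet> (mat_diag d lam *\<^sub>v v)) - Matrix.vec d b \<bullet> v)"
  have f: "f (poly_vec d lam b p) = 1/2 * poly_ip d lam b (pCons 0 p) p - poly_ip d lam b 1 p" for p
    unfolding f_def poly_vec_1[of d lam b, symmetric] mat_diag_mult_poly_vec poly_vec_scalar_prod
    by (simp only: poly_ip_commute[of d lam b p "pCons 0 p"])
  show "poly_vec d lam b P \<in> krylov (mat_diag d lam) (Matrix.vec d b) N"
    using P by (simp add: krylov_mat_diag)
  fix v assume "v \<in> krylov (mat_diag d lam) (Matrix.vec d b) N" "v \<noteq> poly_vec d lam b P"
  then obtain p where p: "v = poly_vec d lam b p" "p \<in> polys_below N" "p \<noteq> P"
    by (auto simp: krylov_mat_diag)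
  define q where "q = p - P"
  have q: "q \<in> polys_below N" "q \<noteq> 0" using p P by (auto simp: q_def intro: polys_below_diff)
  have p_eq: "p = P + q" and add: "pCons 0 (P + q) = pCons 0 P + pCons 0 q" by (simp_all add: q_def)
  have "poly_ip d lam b (pCons 0 P) q = poly_ip d lam b 1 q" using orth[OF q(1)] by (simp add: poly_ip_diff_left)
  moreover have "poly_ip d lam b (pCons 0 q) P = poly_ip d lam b (pCons 0 P) q"
    by (metis poly_ip_pCons_swap poly_ip_commute)
  ultimately have "f v = f (poly_vec d lam b P) + 1/2 * poly_ip d lam b (pCons 0 q) q"
    unfolding p(1) f p_eq by (simp only: add poly_ip_linear) (simp add: algebra_simps)
  then show "1/2 * (poly_vec d lam b P \<bullet> (mat_diag d lam *\<^sub>v poly_vec d lam b P)) - Matrix.vec d b \<bullet> poly_vec d lam b P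
      < 1/2 * (v \<bullet> (mat_diag d lam *\<^sub>v v)) - Matrix.vec d b \<bullet> v"
    using pos[OF q] unfolding f_def by linarith
qed

section \<open>Translation of the polynomial estimates to vectors\<close>

lemma euclid_norm_poly_vec: "euclid_norm (poly_vec d lam b p) = poly_norm d lam b p"
  by (simp add: euclid_norm_def poly_norm_def poly_vec_scalar_prod)


lemma geometric_sum_eq:
  fixes x L :: real
  assumes "x < L" "0 < L"
  shows "(\<Sum>k<n. (1 - x / L) ^ k) / L = (if x = 0 then real n / L else \<bar>((1 - x / L) ^ n - 1) / x\<bar>)"
proof (cases "x = 0")
  case False
  have "x / L * (\<Sum>k<n. (1 - x / L) ^ k) = 1 - (1 - x / L) ^ n"
    using one_diff_power_eq[of "1 - x / L" n] by simp
  then have eq: "((1 - x / L) ^ n - 1) / x = - ((\<Sum>k<n. (1 - x / L) ^ k) / L)"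
    using False assms(2) by (simp add: field_simps)
  have "0 \<le> (\<Sum>k<n. (1 - x / L) ^ k) / L"
    using assms by (intro divide_nonneg_pos sum_nonneg zero_le_power) (auto simp: divide_le_eq)
  then show ?thesis using False unfolding eq by (simp only: if_False abs_minus_cancel abs_of_nonneg)
qed simp

theorem theorem3p9:
  fixes d dt n :: nat and lam b :: "nat \<Rightarrow> real"
    and A At :: "real mat" and bv bt v vt \<sigma> :: "real vec"
  defines "A \<equiv> mat_diag d lam" and "bv \<equiv> Matrix.vec d b"
    and "At \<equiv> mat_diag dt lam" and "bt \<equiv> Matrix.vec dt b"
    and "v \<equiv> cg_iterate A bv n" and "vt \<equiv> cg_iterate At bt n"
    and "\<sigma> \<equiv> sigma_vec d dt lam b n"
  assumes "0 < d" and "d \<le> dt"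
    and "\<And>i j. i \<le> j \<Longrightarrow> j < dt \<Longrightarrow> lam j \<le> lam i"
    and "0 < lam (d - 1)"
    and "d < dt \<Longrightarrow> lam d < lam (d - 1)"
    and "1 \<le> n" and "n \<le> krylov_grade A bv"
    and "l1_norm \<sigma> < 1"
  shows "cg_well_defined At bt n \<and>
    euclid_norm (vec_first vt d - v) \<le> l1_norm \<sigma> / (1 - l1_norm \<sigma>) * euclid_norm v \<and>
    (\<forall>i \<in> {d..<dt}.
       \<bar>vt $ i\<bar> \<le> \<bar>b i\<bar> / (1 - l1_norm \<sigma>) *
         (if lam i = 0 then real n / lam (d - 1)
          else \<bar>((1 - lam i / lam (d - 1)) ^ n - 1) / lam i\<bar>))"
proof -
  note mono = assms(10)
  \<comment> \<open>The bound \<open>L\<close> is \<open>lam (d - 1)\<close>, the smallest of the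
    first \<open>d\<close> nodes.\<close>
  interpret extended_form d lam b n "lam (d - 1)" dt
  proof
    show "poly_ip_definite d lam b n"
      using assms(14) unfolding A_def bv_def le_krylov_grade_iff .
    show "lam (d - 1) \<le> lam i" if "i < d" for i
      using that mono[of i "d - 1"] assms(8,9) by simp
    show "lam i < lam (d - 1)" if "d \<le> i" "i < dt" for i
      using that mono[of d i] assms(12) by simp
  qed (use assms in auto)
  have S: "l1_norm \<sigma> = S" by (simp add: \<sigma>_def S_def)
  then have S_less: "S < 1" using assms(15) by simp
  \<comment> \<open>Both iterates come from the same criterion: here positivity holds because all
    nodes are at least \<open>lam (d - 1)\<close>, for \<open>vt\<close> it is
    \<open>ipt_pCons_pos\<close>.\<close>
  have v: "v = poly_vec d lam b (cg_poly n)"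
    unfolding v_def A_def bv_def
  proof (rule cg_iterate_mat_diag)
    show "0 < ip (pCons 0 p) p" if "p \<in> polys_below n" "p \<noteq> 0" for p
      using poly_ip_pos[OF definite that] poly_ip_pCons_ge[of d "lam (d - 1)" lam b p] L_le L_pos
      by (metis mult_pos_pos less_le_trans)
    show "cg_poly n \<in> polys_below n" by (simp add: res_cg_poly(2))
    show "ip (1 - pCons 0 (cg_poly n)) q = 0" if "q \<in> polys_below n" for q
      using orth_belowD[OF res_cg_poly(8) that] res_cg_poly(1)[of n] by simp
  qed
  have vt: "vt = poly_vec dt lam b ext_poly"
    unfolding vt_def At_def bt_def
    by (rule cg_iterate_mat_diag)
       (use ipt_pCons_pos[OF S_less] ext_poly_below[OF S_less] ext_poly_orth[OF S_less] in blast)+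
  have "vec_first vt d - v = poly_vec d lam b (ext_poly - cg_poly n)"
    unfolding v vt poly_vec_diff using d_le_dt by (auto simp: vec_first_def)
  then have "euclid_norm (vec_first vt d - v) \<le> l1_norm \<sigma> / (1 - l1_norm \<sigma>) * euclid_norm v"
    unfolding v S using ext_poly_diff_norm[OF S_less] by (simp only: euclid_norm_poly_vec)
  moreover have "cg_well_defined At bt n"
    unfolding At_def bt_def using definite_ext ipt_pCons_pos[OF S_less]
    by (rule cg_well_defined_mat_diagI)
  moreover have "\<bar>vt $ i\<bar> \<le> \<bar>b i\<bar> / (1 - l1_norm \<sigma>) *
         (if lam i = 0 then real n / lam (d - 1)
          else \<bar>((1 - lam i / lam (d - 1)) ^ n - 1) / lam i\<bar>)" if i: "i \<in> {d..<dt}" for i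
  proof -
    have less: "lam i < lam (d - 1)" using i lam_ext by simp
    have "\<bar>vt $ i\<bar> = \<bar>b i\<bar> * \<bar>poly ext_poly (lam i)\<bar>" using i by (simp add: vt abs_mult)
    also have "\<dots> \<le> \<bar>b i\<bar> * (1 / (1 - S) * ((\<Sum>k<n. (1 - lam i / lam (d - 1)) ^ k) / lam (d - 1)))"
      using abs_ext_poly_le[OF S_less less] by (rule mult_left_mono) simp
    also have "\<dots> = \<bar>b i\<bar> / (1 - S) * ((\<Sum>k<n. (1 - lam i / lam (d - 1)) ^ k) / lam (d - 1))" by simp
    also have "(\<Sum>k<n. (1 - lam i / lam (d - 1)) ^ k) / lam (d - 1) =
        (if lam i = 0 then real n / lam (d - 1) else \<bar>((1 - lam i / lam (d - 1)) ^ n - 1) / lam i\<bar>)"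
      by (rule geometric_sum_eq[OF less L_pos])
    finally show ?thesis unfolding S .
  qed
  ultimately show ?thesis by blast
qed

end
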